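(* (a) A metric group $G$ is uniformly non-OB if and only if there is a function $s: \mathbb{N} \times \mathbb{N} \rightarrow \mathbb{N}$ such that $G$ has an expansion from $\mathcal{K}_{grey}$ which satisfies all conditions $\theta (m,k,\frac{1}{s(m,k)} )$. (b) The class of uniformly non-OB metric groups is bountiful.
   Context: Metric groups are groups with a complete bi-invariant metric, viewed as continuous structures. A metric group $G$ is uniformly non-OB if there is an open symmetric $V\neq\emptyset$ such that for any natural numbers $m$ and $k$ there is a real $\varepsilon>0$ such that for any $m$-element subset $F\subset G$ there is $g\in G$ which is $\varepsilon$-distant from $(FV)^k$. $\mathcal{K}_{grey}$ is the class of continuous metric structures $\langle G,P,Q\rangle$ where $G$ is a group with a bi-invariant $[0,1]$-valued metric and $P,Q:G\to[0,1]$ are unary predicates with continuity modulus $\mathsf{id}$ satisfying: $\mathsf{sup}_x|P(x)-P(x^{-1})|=0$, $\mathsf{inf}_x|P(x)-1/2|=0$, $\mathsf{sup}_x|Q(x)-Q(x^{-1})|=0$, $\mathsf{inf}_x|Q(x)-1/2|=0$, $Q(1)=0$, $\mathsf{sup}_x\mathsf{min}(P(x),Q(x))=0$, and for all rational $\varepsilon\in[0,\frac12]$: $\mathsf{sup}_x\mathsf{min}(\varepsilon\dot{-}Q(x),\mathsf{inf}_y\mathsf{max}(d(x,y)\dot{-}2\varepsilon,\varepsilon\dot{-}P(y)))=0$ (here $a\dot- b=\max(a-b,0)$). For natural $m,k$ and rational $\varepsilon$, $\theta(m,k,\varepsilon)$ is the condition $\mathsf{sup}_{x_1\ldots x_m}\mathsf{inf}_x\mathsf{sup}_{y_1\ldots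 y_k}\mathsf{min}(P(y_1),\ldots,P(y_k),\varepsilon\dot{-}\mathsf{min}_{w\in W_{m,k}}d(x,w))=0$, where $W_{m,k}$ consists of all words $x_{i_1}y_1x_{i_2}y_2\cdots x_{i_k}y_k$; it says that for any $F=\{x_1,\ldots,x_m\}$ some $x$ is $\varepsilon$-distant from $(F\cdot\{y:P(y)>0\})^k$. A class $\mathcal{K}$ of topological groups is bountiful if for any infinite $H\in\mathcal{K}$ and any $C\subseteq H$ there is $K\in\mathcal{K}$ with $C\subseteq K\le H$ and the density character of $K$ equal to that of $C$.
   Formalization: In (a) the expansion from K_grey may use any complete bi-invariant [0,1]-valued metric giving the topology of G, not G's own metric (with which (a) fails: the integers, nonzero distances 1/10); in (b) density characters are taken to be at least aleph_0. *)

theory Defs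
  imports "HOL-Analysis.Analysis" "HOL-Algebra.Coset"
begin

unbundle cardinal_syntax

section \<open>Metric groups\<close>

text \<open>The metric need not be bounded here; for the [0,1]-valued metrics of
continuous logic see \<open>K_grey\<close> and \<open>grey_expansion\<close> below.\<close>

locale metric_group = group G + Metric_space "carrier G" d
  for G :: "'a monoid" (structure) and d :: "'a \<Rightarrow> 'a \<Rightarrow> real" +
  assumes complete: "mcomplete"
    and left_invariant:
      "\<lbrakk>x \<in> carrier G; y \<in> carrier G; z \<in> carrier G\<rbrakk> \<Longrightarrow> d (z \<otimes> x) (z \<otimes> y) = d x y"
    and right_invariant:
      "\<lbrakk>x \<in> carrier G; y \<in> carrier G; z \<in> carrier G\<rbrakk> \<Longrightarrow> d (x \<otimes> z) (y \<otimes> z) = d x y"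

definition set_power :: "'a monoid \<Rightarrow> 'a set \<Rightarrow> nat \<Rightarrow> 'a set" where
  "set_power G S k = ((\<lambda>T. S <#>\<^bsub>G\<^esub> T) ^^ k) {\<one>\<^bsub>G\<^esub>}"

definition distant_from :: "('a \<Rightarrow> 'a \<Rightarrow> real) \<Rightarrow> real \<Rightarrow> 'a \<Rightarrow> 'a set \<Rightarrow> bool" where
  "distant_from d \<epsilon> g S \<longleftrightarrow> (\<forall>w\<in>S. \<epsilon> \<le> d g w)"

definition uniformly_non_OB :: "'a monoid \<Rightarrow> ('a \<Rightarrow> 'a \<Rightarrow> real) \<Rightarrow> bool" where
  "uniformly_non_OB G d \<longleftrightarrow> metric_group G d \<and>
    (\<exists>V. openin (Metric_space.mtopology (carrier G) d) V \<and> V \<noteq> {} \<and> set_inv\<^bsub>G\<^esub> V = V \<and>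
      (\<forall>m k. \<exists>\<epsilon>>0. \<forall>F. F \<subseteq> carrier G \<and> finite F \<and> card F = m \<longrightarrow>
        (\<exists>g\<in>carrier G. distant_from d \<epsilon> g (set_power G (F <#>\<^bsub>G\<^esub> V) k))))"

section \<open>The class of grey structures\<close>

definition monus :: "real \<Rightarrow> real \<Rightarrow> real" where
  "monus a b = max (a - b) 0"

text \<open>Continuity moduli in the sense of continuous logic.\<close>

definition has_modulus ::
    "'a set \<Rightarrow> ('a \<Rightarrow> 'a \<Rightarrow> real) \<Rightarrow> (real \<Rightarrow> real) \<Rightarrow> ('a \<Rightarrow> real) \<Rightarrow> bool" where
  "has_modulus M d \<Delta> P \<longleftrightarrow>
    (\<forall>\<epsilon>\<in>{0<..1}. \<forall>x\<in>M. \<forall>y\<in>M. d x y < \<Delta> \<epsilon> \<longrightarrow> \<bar>P x - P y\<bar> \<le> \<epsilon>)"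

text \<open>All suprema and infima below are over nonempty index sets and bounded families.
Completeness (part of \<open>metric_group\<close>) is implicit in the notion of a continuous structure.\<close>

definition K_grey ::
    "'a monoid \<Rightarrow> ('a \<Rightarrow> 'a \<Rightarrow> real) \<Rightarrow> ('a \<Rightarrow> real) \<Rightarrow> ('a \<Rightarrow> real) \<Rightarrow> bool" where
  "K_grey G d P Q \<longleftrightarrow>
    metric_group G d \<and> (\<forall>x\<in>carrier G. \<forall>y\<in>carrier G. d x y \<in> {0..1}) \<and>
    P \<in> carrier G \<rightarrow> {0..1} \<and> Q \<in> carrier G \<rightarrow> {0..1} \<and>
    has_modulus (carrier G) d id P \<and> has_modulus (carrier G) d id Q \<and>
    (SUP x\<in>carrier G. \<bar>P x - P (inv\<^bsub>G\<^esub> x)\<bar>) = 0 \<and>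
    (INF x\<in>carrier G. \<bar>P x - 1/2\<bar>) = 0 \<and>
    (SUP x\<in>carrier G. \<bar>Q x - Q (inv\<^bsub>G\<^esub> x)\<bar>) = 0 \<and>
    (INF x\<in>carrier G. \<bar>Q x - 1/2\<bar>) = 0 \<and>
    Q \<one>\<^bsub>G\<^esub> = 0 \<and>
    (SUP x\<in>carrier G. min (P x) (Q x)) = 0 \<and>
    (\<forall>\<epsilon>\<in>\<rat> \<inter> {0..1/2}.
      (SUP x\<in>carrier G. min (monus \<epsilon> (Q x))
        (INF y\<in>carrier G. max (monus (d x y) (2 * \<epsilon>)) (monus \<epsilon> (P y)))) = 0)"

text \<open>A metric group is given with an arbitrary, possibly unbounded, complete bi-invariant
metric \<open>d\<close>. It is viewed as a continuous structure through a [0,1]-valued bi-invariant metric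
\<open>d'\<close> defining the same topology (equivalently, by bi-invariance, the same uniformity), and
it is that structure which is expanded by \<open>P\<close> and \<open>Q\<close>. The choice of \<open>d'\<close> matters: a predicate
with modulus \<open>id\<close> that comes close to 1/2 is bounded away from 0 on a whole group of diameter
below 1/2. For instance the integers with all nonzero distances 1/10 are uniformly non-OB, but
satisfy no condition \<open>\<theta>(1,1,1/s)\<close> for that metric.\<close>

definition grey_expansion ::
    "'a monoid \<Rightarrow> ('a \<Rightarrow> 'a \<Rightarrow> real) \<Rightarrow> ('a \<Rightarrow> 'a \<Rightarrow> real) \<Rightarrow> ('a \<Rightarrow> real) \<Rightarrow> ('a \<Rightarrow> real) \<Rightarrow> bool"
  where
  "grey_expansion G d d' P Q \<longleftrightarrow> K_grey G d' P Q \<and>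
    Metric_space.mtopology (carrier G) d' = Metric_space.mtopology (carrier G) d"

section \<open>The conditions \<open>\<theta>\<close>\<close>

definition tuples :: "'a set \<Rightarrow> nat \<Rightarrow> 'a list set" where
  "tuples A n = {xs. set xs \<subseteq> A \<and> length xs = n}"

text \<open>The values of the words \<open>x\<^sub>i\<^sub>1 y\<^sub>1 x\<^sub>i\<^sub>2 y\<^sub>2 \<dots> x\<^sub>i\<^sub>k y\<^sub>k\<close> (indices \<open>i\<^sub>j\<close> are counted from 0).\<close>

definition words :: "'a monoid \<Rightarrow> 'a list \<Rightarrow> 'a list \<Rightarrow> 'a set" where
  "words G xs ys =
    {foldr (\<lambda>(i, y) g. (xs ! i \<otimes>\<^bsub>G\<^esub> y) \<otimes>\<^bsub>G\<^esub> g) (zip is ys) \<one>\<^bsub>G\<^esub> | is.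
      is \<in> tuples {..<length xs} (length ys)}"

text \<open>The inserted 1 is the largest truth value: it only fixes the value of the empty minimum
(for \<open>k = 0\<close>, respectively for \<open>m = 0 < k\<close>), as \<open>P\<close> and the metric are [0,1]-valued.\<close>

definition theta ::
    "'a monoid \<Rightarrow> ('a \<Rightarrow> 'a \<Rightarrow> real) \<Rightarrow> ('a \<Rightarrow> real) \<Rightarrow> nat \<Rightarrow> nat \<Rightarrow> real \<Rightarrow> bool" where
  "theta G d P m k \<epsilon> \<longleftrightarrow>
    (SUP xs\<in>tuples (carrier G) m. INF x\<in>carrier G. SUP ys\<in>tuples (carrier G) k.
      min (Min (insert 1 (P ` set ys)))
          (monus \<epsilon> (Min (insert 1 (d x ` words G xs ys))))) = 0"

section \<open>Bountiful classes\<close>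

definition dense_subset :: "'a topology \<Rightarrow> 'a set \<Rightarrow> bool" where
  "dense_subset T D \<longleftrightarrow> D \<subseteq> topspace T \<and> Abstract_Topology.closure_of T D = topspace T"

text \<open>As usual for cardinal functions in topology, the density character is an infinite
cardinal: the least cardinality of a dense subset, plus \<open>\<aleph>\<^sub>0\<close>. Without this convention a
finite subset of an infinite group could never have the density character of an infinite
subgroup.\<close>

definition density_character :: "'a topology \<Rightarrow> (nat + 'a) rel" where
  "density_character T =
    natLeq +c card_of (SOME D. dense_subset T D \<and>
      (\<forall>D'. dense_subset T D' \<longrightarrow> card_of D \<le>o card_of D'))"

text \<open>Classes of metrized topological groups are given as predicates; subgroups carry the
restricted metric.\<close>

definition bountiful :: "('a monoid \<Rightarrow> ('a \<Rightarrow> 'a \<Rightarrow> real) \<Rightarrow> bool) \<Rightarrow> bool" where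
  "bountiful \<K> \<longleftrightarrow>
    (\<forall>H d. \<K> H d \<and> infinite (carrier H) \<longrightarrow>
      (\<forall>C \<subseteq> carrier H. \<exists>K. \<K> (H\<lparr>carrier := K\<rparr>) d \<and> C \<subseteq> K \<and> subgroup K H \<and>
        (density_character (Metric_space.mtopology K d),
         density_character (Metric_space.mtopology C d)) \<in> ordIso))"

end

theory Submission
  imports Defs "HOL-Library.Countable_Set_Type"
begin

text \<open>Call \<open>G\<close> unbounded at scale \<open>r\<close> if no finite set \<open>F\<close> and number \<open>k\<close> are such that every point
is reached from \<open>F\<close> by \<open>k\<close> steps shorter than \<open>r\<close>. Since balls around \<open>\<one>\<close> are normal, \<open>G\<close> is uniformly
non-OB iff it is unbounded at some scale \<open>r\<close>; one can then take the ball of radius \<open>r\<close> for \<open>V\<close>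
and \<open>\<epsilon> = r\<close> for all \<open>m\<close> and \<open>k\<close>.

For the expansion, let \<open>d'\<close> be the truncated fourth root of \<open>d / r\<close>, let \<open>U\<close> be the set of end points
of finite chains from \<open>\<one>\<close> whose \<open>n\<close>-th step (counted from 0) is shorter than \<open>2\<^sup>-\<^sup>n r / 16\<close>, and let \<open>P\<close> and \<open>Q\<close>
be the \<open>d'\<close>-distances to the complement of \<open>U\<close> and to \<open>U\<close>, cut off at \<open>1/2\<close>. Cutting a chain short
shows that every point of \<open>U\<close> is close to the centre of a ball of comparable prescribed
radius inside \<open>U\<close>, which is what the last axiom of \<open>K_grey\<close> asks for. Conversely, \<open>P\<close> is at
least \<open>1/4\<close> on a ball around a point where it exceeds \<open>3/8\<close>, so \<open>\<theta>\<close> keeps words with factors from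
that ball from covering \<open>G\<close>.

For bountifulness, unboundedness at scale \<open>r\<close> is witnessed by a countable set \<open>E\<close>, which
contains for every \<open>k\<close> a sequence whose members are not linked by \<open>k\<close> steps. Hence the closure of the
subgroup generated by \<open>E\<close> and a dense subset of \<open>C\<close> is again uniformly non-OB.\<close>

section \<open>Words and powers\<close>

lemma set_power_0 [simp]: "set_power G S 0 = {\<one>\<^bsub>G\<^esub>}"
  and set_power_Suc: "set_power G S (Suc k) = S <#>\<^bsub>G\<^esub> set_power G S k"
  by (simp_all add: set_power_def)

lemma in_set_mult_iff: "w \<in> A <#>\<^bsub>G\<^esub> B \<longleftrightarrow> (\<exists>a\<in>A. \<exists>b\<in>B. w = a \<otimes>\<^bsub>G\<^esub> b)"
  by (auto simp: set_mult_def)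

lemma set_multI: "a \<in> A \<Longrightarrow> b \<in> B \<Longrightarrow> a \<otimes>\<^bsub>G\<^esub> b \<in> A <#>\<^bsub>G\<^esub> B"
  by (auto simp: set_mult_def)

lemma tuples_0 [simp]: "tuples A 0 = {[]}"
  by (auto simp: tuples_def)

lemma tuples_Suc: "tuples A (Suc n) = {x # xs | x xs. x \<in> A \<and> xs \<in> tuples A n}"
  by (auto simp: tuples_def length_Suc_conv)

lemma words_Nil [simp]: "words G xs [] = {\<one>\<^bsub>G\<^esub>}"
  by (simp add: words_def)

lemma words_Cons:
  "words G xs (y # ys) = {(x \<otimes>\<^bsub>G\<^esub> y) \<otimes>\<^bsub>G\<^esub> g | x g. x \<in> set xs \<and> g \<in> words G xs ys}"
proof (intro equalityI subsetI)
  fix w assume "w \<in> words G xs (y # ys)"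
  then obtain i "is" where "i < length xs" "is \<in> tuples {..<length xs} (length ys)"
    "w = (xs ! i \<otimes>\<^bsub>G\<^esub> y) \<otimes>\<^bsub>G\<^esub> foldr (\<lambda>(i, y) g. (xs ! i \<otimes>\<^bsub>G\<^esub> y) \<otimes>\<^bsub>G\<^esub> g) (zip is ys) \<one>\<^bsub>G\<^esub>"
    by (auto simp: words_def tuples_Suc)
  then show "w \<in> {(x \<otimes>\<^bsub>G\<^esub> y) \<otimes>\<^bsub>G\<^esub> g | x g. x \<in> set xs \<and> g \<in> words G xs ys}"
    unfolding words_def by fastforce
next
  fix w assume "w \<in> {(x \<otimes>\<^bsub>G\<^esub> y) \<otimes>\<^bsub>G\<^esub> g | x g. x \<in> set xs \<and> g \<in> words G xs ys}"
  then obtain i "is" where i: "i < length xs" "is \<in> tuples {..<length xs} (length ys)" and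
    w: "w = (xs ! i \<otimes>\<^bsub>G\<^esub> y) \<otimes>\<^bsub>G\<^esub> foldr (\<lambda>(i, y) g. (xs ! i \<otimes>\<^bsub>G\<^esub> y) \<otimes>\<^bsub>G\<^esub> g) (zip is ys) \<one>\<^bsub>G\<^esub>"
    by (auto simp: words_def in_set_conv_nth)
  then show "w \<in> words G xs (y # ys)"
    unfolding words_def by (auto simp: tuples_Suc intro!: exI[of _ "i # is"])
qed

text \<open>The bridge between the powers in \<open>uniformly_non_OB\<close> and the words in
  \<open>theta\<close>. The left side depends on \<open>set xs\<close> alone, so repetitions in a
  tuple are harmless.\<close>

lemma set_power_eq_words:
  "set_power G (set xs <#>\<^bsub>G\<^esub> V) k = (\<Union>ys\<in>tuples V k. words G xs ys)"
proof (induction k)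
  case (Suc k)
  show ?case
    unfolding set_power_Suc Suc.IH tuples_Suc
    by (fastforce simp: in_set_mult_iff words_Cons)
qed simp

lemma finite_set_power: "finite F \<Longrightarrow> finite (set_power G F k)"
  by (induction k) (simp_all add: set_power_Suc set_mult_def)

section \<open>Chains of small steps\<close>

text \<open>Both ends are required to lie in \<open>M\<close>, so a chain in a subset has to stay
  inside that subset.\<close>

definition step_rel :: "'a set \<Rightarrow> ('a \<Rightarrow> 'a \<Rightarrow> real) \<Rightarrow> real \<Rightarrow> 'a rel" where
  "step_rel M d r = {(x, y). x \<in> M \<and> y \<in> M \<and> d x y < r}"

text \<open>For positive \<open>r\<close> a step of a metric may stand still, so \<open>k\<close>
  steps stand for at most \<open>k\<close>. Only the metric enters, not the multiplication, which
  eases the passage to subsets.\<close>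

definition chain_unbounded :: "'a set \<Rightarrow> ('a \<Rightarrow> 'a \<Rightarrow> real) \<Rightarrow> real \<Rightarrow> bool" where
  "chain_unbounded M d r \<longleftrightarrow>
    (\<forall>F k. finite F \<and> F \<subseteq> M \<longrightarrow> \<not> M \<subseteq> (step_rel M d r ^^ k) `` F)"

lemma chain_unboundedE:
  assumes "chain_unbounded M d r" "finite F" "F \<subseteq> M"
  obtains x where "x \<in> M" "x \<notin> (step_rel M d r ^^ k) `` F"
  using assms unfolding chain_unbounded_def by blast

lemma step_rel_pow_mono:
  assumes "M \<subseteq> N"
  shows "step_rel M d r ^^ k \<subseteq> step_rel N d r ^^ k"
proof (induction k)
  case (Suc k)
  have "step_rel M d r \<subseteq> step_rel N d r"
    using assms by (auto simp: step_rel_def)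
  with Suc show ?case
    by (simp add: relcomp_mono)
qed simp

lemma step_rel_pow_closed:
  "(x, y) \<in> step_rel M d r ^^ k \<Longrightarrow> x \<in> M \<Longrightarrow> y \<in> M"
proof (cases k)
  case (Suc n)
  then show "(x, y) \<in> step_rel M d r ^^ k \<Longrightarrow> y \<in> M"
    by (auto simp: step_rel_def)
qed simp

lemma (in Metric_space) step_rel_pow_sym:
  "(x, y) \<in> step_rel M d r ^^ k \<Longrightarrow> (y, x) \<in> step_rel M d r ^^ k"
proof (induction k arbitrary: y)
  case (Suc k)
  then obtain z where "(z, x) \<in> step_rel M d r ^^ k" "(y, z) \<in> step_rel M d r"
    by (auto simp: step_rel_def commute)
  then show ?case
    by (rule relpow_Suc_I2[rotated])
qed simp

section \<open>Chains and words in a group with bi-invariant metric\<close>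

context metric_group
begin

lemma set_power_closed: "S \<subseteq> carrier G \<Longrightarrow> set_power G S k \<subseteq> carrier G"
  by (induction k) (simp_all add: set_power_Suc set_mult_closed)

lemma dist_mult_le:
  assumes "x \<in> carrier G" "y \<in> carrier G" "x' \<in> carrier G" "y' \<in> carrier G"
  shows "d (x \<otimes> y) (x' \<otimes> y') \<le> d x x' + d y y'"
  using triangle[of "x \<otimes> y" "x' \<otimes> y" "x' \<otimes> y'"] assms left_invariant right_invariant by simp

lemma dist_inv:
  assumes "x \<in> carrier G" "y \<in> carrier G"
  shows "d (inv x) (inv y) = d x y"
proof -
  have "d x y = d (inv x \<otimes> x) (inv x \<otimes> y)"
    using left_invariant[of x y "inv x"] assms by simp
  also have "\<dots> = d (\<one> \<otimes> inv y) (inv x \<otimes> y \<otimes> inv y)"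
    using right_invariant[of \<one> "inv x \<otimes> y" "inv y"] assms by simp
  also have "\<dots> = d (inv x) (inv y)"
    using assms by (simp add: m_assoc commute)
  finally show ?thesis ..
qed

lemma dist_one:
  assumes "x \<in> carrier G" "y \<in> carrier G"
  shows "d \<one> (y \<otimes> inv x) = d x y"
  using right_invariant[of x y "inv x"] assms by simp

lemma step_rel_pow_left_mult:
  assumes "g \<in> carrier G" "x \<in> carrier G" "(x, y) \<in> step_rel (carrier G) d r ^^ k"
  shows "(g \<otimes> x, g \<otimes> y) \<in> step_rel (carrier G) d r ^^ k"
  using assms(3)
proof (induction k arbitrary: y)
  case (Suc k)
  then show ?case
    using assms(1) by (auto simp: step_rel_def left_invariant intro!: relcompI)
qed simp

text \<open>By bi-invariance, deleting \<open>b\<close> from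
  \<open>f \<otimes> b \<otimes> u\<close> moves the product by \<open>d \<one> b\<close>, which is
  one step. Left multiplication by \<open>f\<close> preserves the chain already found for
  \<open>u\<close>, so all elements of \<open>F\<close> collect in the starting point.\<close>

lemma set_power_subset_chain:
  assumes "F \<subseteq> carrier G"
  shows "set_power G (F <#> mball \<one> r) k
    \<subseteq> (step_rel (carrier G) d r ^^ k) `` set_power G F k"
proof (induction k)
  case (Suc k)
  show ?case
  proof
    fix w assume "w \<in> set_power G (F <#> mball \<one> r) (Suc k)"
    then obtain f b u where f: "f \<in> F" and b: "b \<in> mball \<one> r"
      and u: "u \<in> set_power G (F <#> mball \<one> r) k" and w: "w = f \<otimes> b \<otimes> u"
      by (auto simp: set_power_Suc in_set_mult_iff)
    from u Suc obtain e where e: "e \<in> set_power G F k"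
      and eu: "(e, u) \<in> step_rel (carrier G) d r ^^ k"
      by blast
    have [simp]: "e \<in> carrier G" "f \<in> carrier G" "b \<in> carrier G"
      using e f b assms set_power_closed[OF assms] by auto
    have [simp]: "u \<in> carrier G"
      using step_rel_pow_closed[OF eu] by simp
    have "d (f \<otimes> u) (f \<otimes> b \<otimes> u) = d \<one> b"
      using left_invariant[of \<one> b f] by (simp add: right_invariant)
    then have "(f \<otimes> u, w) \<in> step_rel (carrier G) d r"
      using b by (simp add: step_rel_def w)
    moreover have "(f \<otimes> e, f \<otimes> u) \<in> step_rel (carrier G) d r ^^ k"
      using eu by (simp add: step_rel_pow_left_mult)
    moreover have "f \<otimes> e \<in> set_power G F (Suc k)"
      using e f by (auto simp: set_power_Suc in_set_mult_iff)
    ultimately show "w \<in> (step_rel (carrier G) d r ^^ Suc k) `` set_power G F (Suc k)"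
      by auto
  qed
qed simp

text \<open>Balls are invariant under conjugation, so a ball around \<open>v\<close> serves as well as one around
\<open>\<one>\<close>; the extra factor and the extra element \<open>\<one>\<close> of \<open>F\<close> make all chains
from \<open>F\<close> words of the same length.\<close>

lemma chain_subset_set_power:
  assumes "F \<subseteq> carrier G" "v \<in> carrier G" "mball v r \<subseteq> V" "0 < r"
  shows "(step_rel (carrier G) d r ^^ k) `` F
    \<subseteq> set_power G (((\<lambda>f. f \<otimes> inv v) ` insert \<one> F) <#> V) (Suc k)"
proof (induction k)
  case 0
  show ?case
  proof
    fix x assume "x \<in> (step_rel (carrier G) d r ^^ 0) `` F"
    then have "x \<in> F"
      by simp
    then have "x \<otimes> inv v \<in> (\<lambda>f. f \<otimes> inv v) ` insert \<one> F"
      by blast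
    moreover have "v \<in> V"
      using assms by auto
    ultimately have "x \<otimes> inv v \<otimes> v \<otimes> \<one>
        \<in> set_power G (((\<lambda>f. f \<otimes> inv v) ` insert \<one> F) <#> V) (Suc 0)"
      unfolding set_power_Suc set_power_0 by (intro set_multI) auto
    moreover have "x \<otimes> inv v \<otimes> v \<otimes> \<one> = x"
      using \<open>x \<in> F\<close> assms by (auto simp: m_assoc)
    ultimately show "x \<in> set_power G (((\<lambda>f. f \<otimes> inv v) ` insert \<one> F) <#> V) (Suc 0)"
      by simp
  qed
next
  case (Suc k)
  show ?case
  proof
    fix x assume "x \<in> (step_rel (carrier G) d r ^^ Suc k) `` F"
    then obtain y where y: "y \<in> (step_rel (carrier G) d r ^^ k) `` F"
      and yx: "(y, x) \<in> step_rel (carrier G) d r"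
      by auto
    then have [simp]: "x \<in> carrier G" "y \<in> carrier G" and dyx: "d y x < r"
      by (auto simp: step_rel_def)
    \<comment> \<open>The step from \<open>y\<close> to \<open>x\<close> is left multiplication by
      \<open>x \<otimes> inv y\<close>. Shifted by \<open>v\<close>, this factor lands in the ball
      around \<open>v\<close>; the letter \<open>\<one> \<otimes> inv v\<close> undoes the
      shift.\<close>
    have "d v (v \<otimes> (x \<otimes> inv y)) = d \<one> (x \<otimes> inv y)"
      using left_invariant[of \<one> "x \<otimes> inv y" v] assms(2) by simp
    then have "v \<otimes> (x \<otimes> inv y) \<in> V"
      using assms dyx by (intro subsetD[OF assms(3)]) (simp add: dist_one)
    moreover have "\<one> \<otimes> inv v \<in> (\<lambda>f. f \<otimes> inv v) ` insert \<one> F"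
      by simp
    moreover have "y \<in> set_power G (((\<lambda>f. f \<otimes> inv v) ` insert \<one> F) <#> V) (Suc k)"
      using Suc y by blast
    ultimately have "\<one> \<otimes> inv v \<otimes> (v \<otimes> (x \<otimes> inv y)) \<otimes> y
        \<in> set_power G (((\<lambda>f. f \<otimes> inv v) ` insert \<one> F) <#> V) (Suc (Suc k))"
      unfolding set_power_Suc[of G _ "Suc k"] by (intro set_multI)
    moreover have "\<one> \<otimes> inv v \<otimes> (v \<otimes> (x \<otimes> inv y)) \<otimes> y = x"
      using assms(2) by (simp add: m_assoc[symmetric]) (simp add: m_assoc)
    ultimately show "x \<in> set_power G (((\<lambda>f. f \<otimes> inv v) ` insert \<one> F) <#> V) (Suc (Suc k))"
      by simp
  qed
qed

text \<open>A point outside the \<open>k + 1\<close> step neighbourhood is at distance \<open>r\<close> from the \<open>k\<close> step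
neighbourhood, so one constant \<open>\<epsilon> = r\<close> serves all \<open>m\<close> and \<open>k\<close>.\<close>

lemma chain_unbounded_imp_distant:
  assumes "chain_unbounded (carrier G) d r" "finite F" "F \<subseteq> carrier G"
  obtains g where "g \<in> carrier G" "distant_from d r g (set_power G (F <#> mball \<one> r) k)"
proof -
  have sub: "set_power G F k \<subseteq> carrier G"
    using assms(3) by (rule set_power_closed)
  obtain g where g: "g \<in> carrier G"
    "g \<notin> (step_rel (carrier G) d r ^^ Suc k) `` set_power G F k"
    using chain_unboundedE[OF assms(1) finite_set_power[OF assms(2)] sub] by metis
  have "r \<le> d g w" if w: "w \<in> set_power G (F <#> mball \<one> r) k" for w
  proof (rule ccontr)
    assume "\<not> r \<le> d g w"
    obtain e where e: "e \<in> set_power G F k" "(e, w) \<in> step_rel (carrier G) d r ^^ k"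
      using w set_power_subset_chain[OF assms(3)] by blast
    then have "w \<in> carrier G"
      using step_rel_pow_closed[OF e(2)] sub by auto
    then have "(w, g) \<in> step_rel (carrier G) d r"
      using \<open>\<not> r \<le> d g w\<close> g by (simp add: step_rel_def commute)
    with e g(2) show False
      by auto
  qed
  with g(1) show ?thesis
    using that by (auto simp: distant_from_def)
qed

end

text \<open>Forward, \<open>r\<close> is the radius of a ball inside \<open>V\<close>: if chains
  from \<open>F\<close> covered the group, then so would words of length \<open>Suc k\<close> over
  \<open>?F\<close>, and no point is at positive distance from a set containing it. Backward, the
  ball of radius \<open>r\<close> around \<open>\<one>\<close> is symmetric because inversion is an
  isometry.\<close>

lemma uniformly_non_OB_iff:
  "uniformly_non_OB G d \<longleftrightarrow> metric_group G d \<and> (\<exists>r>0. chain_unbounded (carrier G) d r)"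
proof (cases "metric_group G d")
  case True
  then interpret metric_group G d .
  show ?thesis
  proof (intro iffI conjI)
    assume "uniformly_non_OB G d"
    then obtain V where V: "openin mtopology V" "V \<noteq> {}"
      and far: "\<And>m k. \<exists>\<epsilon>>0. \<forall>F. F \<subseteq> carrier G \<and> finite F \<and> card F = m \<longrightarrow>
        (\<exists>g\<in>carrier G. distant_from d \<epsilon> g (set_power G (F <#>\<^bsub>G\<^esub> V) k))"
      unfolding uniformly_non_OB_def by blast
    then obtain v r where v: "v \<in> V" "0 < r" "mball v r \<subseteq> V"
      unfolding openin_mtopology by blast
    then have vG: "v \<in> carrier G"
      using V openin_mtopology by blast
    have "\<not> carrier G \<subseteq> (step_rel (carrier G) d r ^^ k) `` F" if "finite F" "F \<subseteq> carrier G" for F k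
    proof
      assume cover: "carrier G \<subseteq> (step_rel (carrier G) d r ^^ k) `` F"
      let ?F = "(\<lambda>f. f \<otimes>\<^bsub>G\<^esub> inv\<^bsub>G\<^esub> v) ` insert \<one>\<^bsub>G\<^esub> F"
      obtain \<epsilon> where "\<epsilon> > 0" and "\<And>F'. F' \<subseteq> carrier G \<Longrightarrow> finite F' \<Longrightarrow> card F' = card ?F \<Longrightarrow>
        (\<exists>g\<in>carrier G. distant_from d \<epsilon> g (set_power G (F' <#>\<^bsub>G\<^esub> V) (Suc k)))"
        using far[of "card ?F" "Suc k"] by blast
      from this(2)[of ?F] that vG obtain g where g: "g \<in> carrier G"
        "distant_from d \<epsilon> g (set_power G (?F <#>\<^bsub>G\<^esub> V) (Suc k))"
        by auto
      moreover have "g \<in> set_power G (?F <#>\<^bsub>G\<^esub> V) (Suc k)"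
        using chain_subset_set_power[OF that(2) vG v(3,2), of k] cover g by blast
      ultimately have "\<epsilon> \<le> d g g"
        unfolding distant_from_def by blast
      with \<open>\<epsilon> > 0\<close> g show False
        by simp
    qed
    then show "\<exists>r>0. chain_unbounded (carrier G) d r"
      using v(2) by (auto simp: chain_unbounded_def)
  next
    assume "metric_group G d \<and> (\<exists>r>0. chain_unbounded (carrier G) d r)"
    then obtain r where r: "r > 0" "chain_unbounded (carrier G) d r"
      by blast
    have inv_ball: "inv\<^bsub>G\<^esub> x \<in> mball \<one>\<^bsub>G\<^esub> r" if "x \<in> mball \<one>\<^bsub>G\<^esub> r" for x
      using that dist_inv[of "\<one>\<^bsub>G\<^esub>" x] by simp
    have "set_inv\<^bsub>G\<^esub> (mball \<one>\<^bsub>G\<^esub> r) = mball \<one>\<^bsub>G\<^esub> r"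
    proof (intro equalityI subsetI)
      fix x assume "x \<in> mball \<one>\<^bsub>G\<^esub> r"
      then have "inv\<^bsub>G\<^esub> x \<in> mball \<one>\<^bsub>G\<^esub> r" "x = inv\<^bsub>G\<^esub> (inv\<^bsub>G\<^esub> x)"
        using inv_ball by auto
      then show "x \<in> set_inv\<^bsub>G\<^esub> (mball \<one>\<^bsub>G\<^esub> r)"
        unfolding SET_INV_def by (metis UN_iff singletonI)
    qed (use inv_ball in \<open>auto simp: SET_INV_def\<close>)
    moreover have "\<exists>g\<in>carrier G. distant_from d r g (set_power G (F <#>\<^bsub>G\<^esub> mball \<one>\<^bsub>G\<^esub> r) k)"
      if "F \<subseteq> carrier G" "finite F" for F k
      using chain_unbounded_imp_distant[OF r(2)] that by metis
    ultimately show "uniformly_non_OB G d"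
      using r(1) True unfolding uniformly_non_OB_def
      by (intro conjI exI[of _ "mball \<one>\<^bsub>G\<^esub> r"] allI exI[of _ r]) auto
  qed (use True in auto)
qed (simp add: uniformly_non_OB_def)

section \<open>Distances to sets\<close>

text \<open>The counterpart of \<open>infdist\<close> for a metric given as an explicit function.
  The value for empty \<open>A\<close> is arbitrary.\<close>

definition inf_dist :: "('a \<Rightarrow> 'a \<Rightarrow> real) \<Rightarrow> 'a set \<Rightarrow> 'a \<Rightarrow> real" where
  "inf_dist d A x = (INF a\<in>A. d x a)"

lemma inf_dist_geI:
  assumes "A \<noteq> {}" "\<And>a. a \<in> A \<Longrightarrow> \<epsilon> \<le> d x a"
  shows "\<epsilon> \<le> inf_dist d A x"
  using assms unfolding inf_dist_def by (rule cINF_greatest)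

context Metric_space
begin

lemma bdd_below_dist: "bdd_below (d x ` A)"
  by (rule bdd_belowI[of _ 0]) auto

lemma inf_dist_nonneg: "A \<noteq> {} \<Longrightarrow> 0 \<le> inf_dist d A x"
  by (rule inf_dist_geI) auto

lemma inf_dist_le: "a \<in> A \<Longrightarrow> inf_dist d A x \<le> d x a"
  unfolding inf_dist_def by (rule cINF_lower[OF bdd_below_dist])

lemma inf_dist_lessE:
  assumes "A \<noteq> {}" "inf_dist d A x < \<epsilon>"
  obtains a where "a \<in> A" "d x a < \<epsilon>"
  using assms inf_dist_geI[of A \<epsilon> d x] by force

lemma inf_dist_eq_0: "A \<subseteq> M \<Longrightarrow> x \<in> A \<Longrightarrow> inf_dist d A x = 0"
  using inf_dist_le[of x A x] inf_dist_nonneg[of A x] by fastforce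

lemma inf_dist_triangle:
  assumes "A \<subseteq> M" "A \<noteq> {}" "x \<in> M" "y \<in> M"
  shows "inf_dist d A x \<le> d x y + inf_dist d A y"
proof -
  have "inf_dist d A x - d x y \<le> inf_dist d A y"
  proof (rule inf_dist_geI[OF assms(2)])
    fix a assume "a \<in> A"
    then show "inf_dist d A x - d x y \<le> d y a"
      using inf_dist_le[of a A x] triangle[of x y a] assms by force
  qed
  then show ?thesis
    by simp
qed

text \<open>The distance to a set is 1-Lipschitz, and so is its truncation at
  \<open>c\<close>.\<close>

lemma has_modulus_inf_dist:
  assumes "A \<subseteq> M" "A \<noteq> {}"
  shows "has_modulus M d id (\<lambda>x. min c (inf_dist d A x))"
  unfolding has_modulus_def
proof (intro ballI impI)
  fix \<epsilon> :: real and x y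
  assume "x \<in> M" "y \<in> M" "d x y < id \<epsilon>"
  then show "\<bar>min c (inf_dist d A x) - min c (inf_dist d A y)\<bar> \<le> \<epsilon>"
    using inf_dist_triangle[OF assms, of x y] inf_dist_triangle[OF assms, of y x] commute[of x y]
    unfolding id_apply by linarith
qed

end

section \<open>A union of balls of all small radii\<close>

primrec dyadic_chain :: "'a set \<Rightarrow> ('a \<Rightarrow> 'a \<Rightarrow> real) \<Rightarrow> 'a \<Rightarrow> real \<Rightarrow> nat \<Rightarrow> 'a set" where
  "dyadic_chain M d a c 0 = {a}"
| "dyadic_chain M d a c (Suc n) = {z \<in> M. \<exists>y\<in>dyadic_chain M d a c n. d y z < c / 2 ^ n}"

text \<open>The geometric decay of the steps keeps the set within \<open>2 * c\<close> of
  \<open>a\<close>, while it contains balls of all small radii near each of its points.\<close>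

definition dyadic_nhd :: "'a set \<Rightarrow> ('a \<Rightarrow> 'a \<Rightarrow> real) \<Rightarrow> 'a \<Rightarrow> real \<Rightarrow> 'a set" where
  "dyadic_nhd M d a c = (\<Union>n. dyadic_chain M d a c n)"

text \<open>Meant for inversion, an isometry fixing \<open>\<one>\<close>. Membership of
  \<open>z\<close> in \<open>M\<close> is carried through the induction because the isometry
  condition is only assumed on \<open>M\<close>.\<close>

lemma dyadic_chain_isometry:
  assumes "\<phi> \<in> M \<rightarrow> M" "\<And>x y. x \<in> M \<Longrightarrow> y \<in> M \<Longrightarrow> d (\<phi> x) (\<phi> y) = d x y" "\<phi> a = a" "a \<in> M"
  shows "z \<in> dyadic_chain M d a c n \<Longrightarrow> z \<in> M \<and> \<phi> z \<in> dyadic_chain M d a c n"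
proof (induction n arbitrary: z)
  case (Suc n)
  then obtain y where "z \<in> M" "y \<in> dyadic_chain M d a c n" "d y z < c / 2 ^ n"
    by auto
  moreover from Suc.IH[OF this(2)] have "y \<in> M" "\<phi> y \<in> dyadic_chain M d a c n"
    by auto
  moreover have "\<phi> z \<in> M"
    using assms(1) \<open>z \<in> M\<close> by auto
  ultimately show ?case
    using assms(2)[of y z] by (auto intro!: bexI[of _ "\<phi> y"])
qed (use assms in auto)

context Metric_space
begin

lemma dyadic_chain_subset: "a \<in> M \<Longrightarrow> dyadic_chain M d a c n \<subseteq> M"
  by (cases n) auto

lemma dyadic_nhd_subset: "a \<in> M \<Longrightarrow> dyadic_nhd M d a c \<subseteq> M"
  using dyadic_chain_subset by (auto simp: dyadic_nhd_def)

lemma centre_in_dyadic_nhd: "a \<in> dyadic_nhd M d a c"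
  unfolding dyadic_nhd_def by (rule UN_I[of 0]) auto

lemma mball_subset_dyadic_nhd:
  assumes "y \<in> dyadic_chain M d a c n"
  shows "mball y (c / 2 ^ n) \<subseteq> dyadic_nhd M d a c"
proof
  fix z assume "z \<in> mball y (c / 2 ^ n)"
  then have "z \<in> dyadic_chain M d a c (Suc n)"
    using assms by auto
  then show "z \<in> dyadic_nhd M d a c"
    unfolding dyadic_nhd_def by blast
qed

lemma dyadic_chain_mono:
  assumes "a \<in> M" "0 < c" "m \<le> n"
  shows "dyadic_chain M d a c m \<subseteq> dyadic_chain M d a c n"
proof (rule lift_Suc_mono_le[OF _ assms(3)])
  fix n
  show "dyadic_chain M d a c n \<subseteq> dyadic_chain M d a c (Suc n)"
  proof
    fix z assume z: "z \<in> dyadic_chain M d a c n"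
    then have "z \<in> M"
      using dyadic_chain_subset[OF assms(1)] by auto
    moreover from this have "d z z < c / 2 ^ n"
      using assms(2) by simp
    ultimately show "z \<in> dyadic_chain M d a c (Suc n)"
      using z by (auto intro!: bexI[of _ z])
  qed
qed

text \<open>Dropping the steps with indices from \<open>m\<close> to \<open>n - 1\<close> moves the
  end point by at most the geometric sum of their bounds. The bound is this sum in closed form,
  which is what the induction carries along.\<close>

lemma dyadic_chain_approx:
  assumes "a \<in> M" "m \<le> n" "z \<in> dyadic_chain M d a c n"
  shows "\<exists>y\<in>dyadic_chain M d a c m. d y z \<le> 2 * (c / 2 ^ m - c / 2 ^ n)"
  using assms(2,3)
proof (induction n arbitrary: z rule: dec_induct)
  case base
  then show ?case
    using subsetD[OF dyadic_chain_subset[OF assms(1)] base] by (intro bexI[of _ z]) auto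
next
  case (step n)
  then obtain x where x: "z \<in> M" "x \<in> dyadic_chain M d a c n" "d x z < c / 2 ^ n"
    by auto
  with step.IH obtain y where y: "y \<in> dyadic_chain M d a c m" "d y x \<le> 2 * (c / 2 ^ m - c / 2 ^ n)"
    by blast
  have "x \<in> M" "y \<in> M"
    using x y dyadic_chain_subset[OF assms(1)] by auto
  then have "d y z \<le> 2 * (c / 2 ^ m - c / 2 ^ n) + c / 2 ^ n"
    using triangle[of y x z] x y by simp
  also have "\<dots> = 2 * (c / 2 ^ m - c / 2 ^ Suc n)"
    by (simp add: field_simps)
  finally show ?case
    using y(1) by blast
qed

text \<open>A chain longer than \<open>m\<close> is cut after \<open>m\<close> steps; a shorter one
  is prolonged by steps that stand still, which are allowed as \<open>0 < c\<close>.\<close>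

lemma dyadic_nhd_approx:
  assumes "a \<in> M" "0 < c" "z \<in> dyadic_nhd M d a c"
  shows "\<exists>y\<in>dyadic_chain M d a c m. d y z < 2 * (c / 2 ^ m)"
proof -
  obtain n where n: "z \<in> dyadic_chain M d a c n"
    using assms(3) by (auto simp: dyadic_nhd_def)
  show ?thesis
  proof (cases "m \<le> n")
    case True
    have "0 < c / 2 ^ n"
      using assms(2) by simp
    with dyadic_chain_approx[OF assms(1) True n] show ?thesis
      by force
  next
    case False
    then have "z \<in> dyadic_chain M d a c m"
      using dyadic_chain_mono[OF assms(1,2), of n m] n by auto
    moreover have "d z z < 2 * (c / 2 ^ m)"
      using assms subsetD[OF dyadic_nhd_subset[OF assms(1)] assms(3)] by simp
    ultimately show ?thesis
      by blast
  qed
qed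

lemma dyadic_nhd_bounded:
  assumes "a \<in> M" "0 < c" "z \<in> dyadic_nhd M d a c"
  shows "d a z < 2 * c"
  using dyadic_nhd_approx[OF assms, of 0] by simp

text \<open>Take \<open>j\<close> with \<open>c / 2 ^ Suc j < \<rho> \<le> c / 2 ^ j\<close> and cut
  the chain to \<open>z\<close> after \<open>j\<close> steps. The cut point carries a ball of radius
  \<open>c / 2 ^ j\<close> and lies within \<open>2 * (c / 2 ^ j) < 4 * \<rho>\<close> of
  \<open>z\<close>.\<close>

lemma dyadic_nhd_inner_ball:
  assumes "a \<in> M" "0 < c" "z \<in> dyadic_nhd M d a c" "0 < \<rho>" "\<rho> \<le> c"
  shows "\<exists>y\<in>M. d z y < 4 * \<rho> \<and> mball y \<rho> \<subseteq> dyadic_nhd M d a c"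
proof -
  obtain n where "(1 / 2) ^ n < \<rho> / c"
    using real_arch_pow_inv[of "\<rho> / c" "1 / 2"] assms by auto
  then have "c / 2 ^ n < \<rho>"
    using assms(2) by (simp add: field_simps)
  moreover have "c / 2 ^ Suc n \<le> c / 2 ^ n"
    using assms(2) by (simp add: field_simps)
  ultimately have ex: "c / 2 ^ Suc n < \<rho>"
    by linarith
  define j where "j = (LEAST n. c / 2 ^ Suc n < \<rho>)"
  have less: "c / 2 ^ Suc j < \<rho>"
    unfolding j_def using ex by (rule LeastI)
  \<comment> \<open>This is minimality of \<open>j\<close>, except for \<open>j = 0\<close>, where
    it is the hypothesis \<open>\<rho> \<le> c\<close>.\<close>
  have le: "\<rho> \<le> c / 2 ^ j"
  proof (cases j)
    case (Suc i)
    then have "\<not> c / 2 ^ Suc i < \<rho>"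
      using not_less_Least[of i "\<lambda>n. c / 2 ^ Suc n < \<rho>"] by (simp add: j_def)
    with Suc show ?thesis
      by simp
  qed (use assms in simp)
  obtain y where y: "y \<in> dyadic_chain M d a c j" "d y z < 2 * (c / 2 ^ j)"
    using dyadic_nhd_approx[OF assms(1-3)] by blast
  have "y \<in> M"
    using y(1) dyadic_chain_subset[OF assms(1)] by auto
  moreover have "d z y < 4 * \<rho>"
    using y(2) less by (simp add: commute)
  moreover have "mball y \<rho> \<subseteq> dyadic_nhd M d a c"
    using mball_subset_dyadic_nhd[OF y(1)] mball_subset_concentric[OF le] by blast
  ultimately show ?thesis
    by blast
qed

end

section \<open>Snowflake metrics\<close>

text \<open>With a fourth root, doubling a small new radius multiplies the old radius by 16; a
  single square root would give 4, less than the factor five that arises in the last axiom of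
  \<open>K_grey\<close>. Iterating \<open>sqrt\<close> reduces the triangle inequality to
  subadditivity of \<open>sqrt\<close>.\<close>

definition snowflake :: "('a \<Rightarrow> 'a \<Rightarrow> real) \<Rightarrow> real \<Rightarrow> 'a \<Rightarrow> 'a \<Rightarrow> real" where
  "snowflake d r x y = min 1 (sqrt (sqrt (d x y / r)))"

lemma snowflake_less_iff:
  assumes "0 < r" "0 < \<epsilon>" "\<epsilon> \<le> 1"
  shows "snowflake d r x y < \<epsilon> \<longleftrightarrow> d x y < r * \<epsilon> ^ 4"
proof -
  have "sqrt (sqrt ((\<epsilon>\<^sup>2)\<^sup>2)) = \<epsilon>"
    using assms by (simp only: real_sqrt_abs) simp
  then have "sqrt (sqrt (\<epsilon> ^ 4)) = \<epsilon>"
    by (simp flip: power_mult)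
  then have "snowflake d r x y < \<epsilon> \<longleftrightarrow> sqrt (sqrt (d x y / r)) < sqrt (sqrt (\<epsilon> ^ 4))"
    using assms by (auto simp: snowflake_def)
  also have "\<dots> \<longleftrightarrow> d x y < r * \<epsilon> ^ 4"
    using assms by (simp add: field_simps)
  finally show ?thesis .
qed

lemma snowflake_le_1: "snowflake d r x y \<le> 1"
  by (simp add: snowflake_def)

lemma openin_mtopology_refine:
  assumes "Metric_space M d" "Metric_space M d'"
    and refine: "\<And>\<epsilon>. 0 < \<epsilon> \<Longrightarrow> \<exists>\<delta>>0. \<forall>x y. d x y < \<delta> \<longrightarrow> d' x y < \<epsilon>"
    and "openin (Metric_space.mtopology M d') U"
  shows "openin (Metric_space.mtopology M d) U"
proof -
  interpret A: Metric_space M d by fact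
  interpret B: Metric_space M d' by fact
  show ?thesis
    unfolding A.openin_mtopology
  proof (intro conjI allI impI)
    show "U \<subseteq> M"
      using assms(4) unfolding B.openin_mtopology by blast
    fix x assume "x \<in> U"
    then obtain \<epsilon> where \<epsilon>: "0 < \<epsilon>" "B.mball x \<epsilon> \<subseteq> U"
      using assms(4) unfolding B.openin_mtopology by blast
    then obtain \<delta> where "\<delta> > 0" "\<And>x y. d x y < \<delta> \<Longrightarrow> d' x y < \<epsilon>"
      using refine by blast
    then show "\<exists>r>0. A.mball x r \<subseteq> U"
      using \<epsilon> by (intro exI[of _ \<delta>]) (auto simp: subset_iff)
  qed
qed

context Metric_space
begin

lemma Metric_space_snowflake:
  assumes "0 < r"
  shows "Metric_space M (snowflake d r)"
proof
  fix x y z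
  show "0 \<le> snowflake d r x y"
    using assms by (simp add: snowflake_def)
  show "snowflake d r x y = snowflake d r y x"
    by (simp add: snowflake_def commute)
  show "snowflake d r x y = 0 \<longleftrightarrow> x = y" if "x \<in> M" "y \<in> M"
    using that assms by (auto simp: snowflake_def min_def)
  show "snowflake d r x z \<le> snowflake d r x y + snowflake d r y z"
    if "x \<in> M" "y \<in> M" "z \<in> M"
  proof -
    have "sqrt (sqrt (d x z / r)) \<le> sqrt (sqrt (d x y / r + d y z / r))"
      using triangle[OF that] assms by (simp add: add_divide_distrib[symmetric] divide_right_mono)
    also have "\<dots> \<le> sqrt (sqrt (d x y / r) + sqrt (d y z / r))"
      using assms by (simp add: sqrt_add_le_add_sqrt)
    also have "\<dots> \<le> sqrt (sqrt (d x y / r)) + sqrt (sqrt (d y z / r))"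
      using assms by (intro sqrt_add_le_add_sqrt) auto
    moreover have "0 \<le> sqrt (sqrt (d x y / r))" "0 \<le> sqrt (sqrt (d y z / r))"
      using assms by auto
    ultimately show ?thesis
      unfolding snowflake_def by linarith
  qed
qed

text \<open>The two metrics are uniformly equivalent; hence they share topology and
  completeness.\<close>

lemma snowflake_uniform:
  assumes "0 < r" "0 < \<epsilon>"
  shows "\<exists>\<delta>>0. \<forall>x y. d x y < \<delta> \<longrightarrow> snowflake d r x y < \<epsilon>"
    and "\<exists>\<delta>>0. \<forall>x y. snowflake d r x y < \<delta> \<longrightarrow> d x y < \<epsilon>"
proof -
  have "snowflake d r x y < \<epsilon>" if "d x y < r * min 1 \<epsilon> ^ 4" for x y
    using snowflake_less_iff[of r "min 1 \<epsilon>" d x y] that assms by auto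
  then show "\<exists>\<delta>>0. \<forall>x y. d x y < \<delta> \<longrightarrow> snowflake d r x y < \<epsilon>"
    using assms by (intro exI[of _ "r * min 1 \<epsilon> ^ 4"]) auto
next
  \<comment> \<open>With \<open>\<delta>\<close> at most 1, the crude bound
    \<open>\<delta> ^ 4 \<le> \<delta>\<close> avoids taking a fourth root of
    \<open>\<epsilon> / r\<close>.\<close>
  define \<delta> where "\<delta> = min 1 (\<epsilon> / r)"
  have \<delta>: "0 < \<delta>" "\<delta> \<le> 1" "r * \<delta> \<le> \<epsilon>"
    using assms by (auto simp: \<delta>_def min_def field_simps)
  have "\<delta> ^ 4 \<le> \<delta> ^ 1"
    using \<delta> by (intro power_decreasing) auto
  then have "r * \<delta> ^ 4 \<le> \<epsilon>"
    using \<delta> assms by (smt (verit) mult_left_mono power_one_right)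
  then have "d x y < \<epsilon>" if "snowflake d r x y < \<delta>" for x y
    using snowflake_less_iff[of r \<delta> d x y] that assms \<delta> by auto
  then show "\<exists>\<delta>>0. \<forall>x y. snowflake d r x y < \<delta> \<longrightarrow> d x y < \<epsilon>"
    using \<delta>(1) by blast
qed

lemma mtopology_snowflake:
  assumes "0 < r"
  shows "Metric_space.mtopology M (snowflake d r) = mtopology"
  unfolding topology_eq
  using openin_mtopology_refine[OF Metric_space_axioms Metric_space_snowflake[OF assms]]
    openin_mtopology_refine[OF Metric_space_snowflake[OF assms] Metric_space_axioms]
    snowflake_uniform[OF assms] by metis

lemma mcomplete_snowflake:
  assumes "0 < r" "mcomplete"
  shows "Metric_space.mcomplete M (snowflake d r)"
proof -
  interpret S: Metric_space M "snowflake d r"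
    using assms(1) by (rule Metric_space_snowflake)
  have "MCauchy \<sigma>" if "S.MCauchy \<sigma>" for \<sigma>
    unfolding MCauchy_def
  proof (intro conjI allI impI)
    show "range \<sigma> \<subseteq> M"
      using that by (simp add: S.MCauchy_def)
    fix \<epsilon> :: real assume "0 < \<epsilon>"
    then obtain \<delta> where "\<delta> > 0" "\<And>x y. snowflake d r x y < \<delta> \<Longrightarrow> d x y < \<epsilon>"
      using snowflake_uniform(2)[OF assms(1)] by blast
    with that show "\<exists>N. \<forall>n n'. N \<le> n \<longrightarrow> N \<le> n' \<longrightarrow> d (\<sigma> n) (\<sigma> n') < \<epsilon>"
      unfolding S.MCauchy_def by meson
  qed
  with assms(2) show ?thesis
    unfolding S.mcomplete_def mcomplete_def mtopology_snowflake[OF assms(1)] by blast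
qed

end

lemma (in metric_group) metric_group_snowflake:
  assumes "0 < r"
  shows "metric_group G (snowflake d r)"
  by (intro metric_group.intro metric_group_axioms.intro group_axioms
      Metric_space_snowflake mcomplete_snowflake assms complete)
    (simp_all add: snowflake_def left_invariant right_invariant)

section \<open>Grey expansions\<close>

lemma SUP_eq_0: "A \<noteq> {} \<Longrightarrow> (\<And>x. x \<in> A \<Longrightarrow> f x = 0) \<Longrightarrow> (SUP x\<in>A. f x) = (0::real)"
  by simp

lemma INF_eq_0:
  "(\<And>y. y \<in> A \<Longrightarrow> 0 \<le> f y) \<Longrightarrow> x \<in> A \<Longrightarrow> f x = 0 \<Longrightarrow> (INF y\<in>A. f y) = (0::real)"
  by (rule cInf_eq_minimum) force+

text \<open>The bounds 0 and \<open>c\<close> ensure that all suprema and infima are genuine ones.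
  The infimum over \<open>Y\<close> may fail to be attained, so its vanishing is expressed through
  arbitrarily small \<open>\<delta>\<close>.\<close>

lemma SUP_INF_SUP_eq_0_iff:
  fixes f :: "'x \<Rightarrow> 'y \<Rightarrow> 'z \<Rightarrow> real"
  assumes ne: "X \<noteq> {}" "Y \<noteq> {}" "Z \<noteq> {}"
    and f: "\<And>x y z. x \<in> X \<Longrightarrow> y \<in> Y \<Longrightarrow> z \<in> Z \<Longrightarrow> 0 \<le> f x y z \<and> f x y z \<le> c"
  shows "(SUP x\<in>X. INF y\<in>Y. SUP z\<in>Z. f x y z) = 0
    \<longleftrightarrow> (\<forall>x\<in>X. \<forall>\<delta>>0. \<exists>y\<in>Y. \<forall>z\<in>Z. f x y z < \<delta>)"
proof -
  define S where "S x y = (SUP z\<in>Z. f x y z)" for x y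
  have le_S: "f x y z \<le> S x y" if "x \<in> X" "y \<in> Y" "z \<in> Z" for x y z
    unfolding S_def using that f by (intro cSUP_upper bdd_aboveI[of _ c]) auto
  have S: "0 \<le> S x y" "S x y \<le> c" if "x \<in> X" "y \<in> Y" for x y
  proof -
    obtain z where "z \<in> Z"
      using ne by blast
    then show "0 \<le> S x y"
      using le_S[of x y z] f[of x y z] that by linarith
    show "S x y \<le> c"
      unfolding S_def using ne f that by (intro cSUP_least) auto
  qed
  have bdd: "bdd_below (S x ` Y)" if "x \<in> X" for x
    using S that by (intro bdd_belowI[of _ 0]) auto
  have I: "0 \<le> (INF y\<in>Y. S x y)" "(INF y\<in>Y. S x y) \<le> c" if "x \<in> X" for x
  proof -
    show "0 \<le> (INF y\<in>Y. S x y)"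
      using ne S that by (intro cINF_greatest) auto
    obtain y where "y \<in> Y"
      using ne by blast
    then show "(INF y\<in>Y. S x y) \<le> c"
      using cINF_lower[OF bdd[OF that]] S(2)[OF that] by force
  qed
  have bddI: "bdd_above ((\<lambda>x. INF y\<in>Y. S x y) ` X)"
    using I by (intro bdd_aboveI[of _ c]) auto
  have "(SUP x\<in>X. INF y\<in>Y. S x y) = 0 \<longleftrightarrow> (\<forall>x\<in>X. \<forall>\<delta>>0. \<exists>y\<in>Y. \<forall>z\<in>Z. f x y z < \<delta>)"
  proof (intro iffI ballI allI impI)
    fix x \<delta> assume 0: "(SUP x\<in>X. INF y\<in>Y. S x y) = 0" and x: "x \<in> X" and "0 < (\<delta>::real)"
    then have "(INF y\<in>Y. S x y) < \<delta>"
      using cSUP_upper[OF x bddI] by simp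
    then obtain y where "y \<in> Y" "S x y < \<delta>"
      using cINF_less_iff[OF ne(2) bdd[OF x]] by blast
    then show "\<exists>y\<in>Y. \<forall>z\<in>Z. f x y z < \<delta>"
      using le_S[OF x] by force
  next
    assume *: "\<forall>x\<in>X. \<forall>\<delta>>0. \<exists>y\<in>Y. \<forall>z\<in>Z. f x y z < \<delta>"
    have "(INF y\<in>Y. S x y) = 0" if x: "x \<in> X" for x
    proof (rule antisym)
      show "(INF y\<in>Y. S x y) \<le> 0"
      proof (rule field_le_epsilon)
        fix \<delta> :: real assume "0 < \<delta>"
        then obtain y where y: "y \<in> Y" "\<And>z. z \<in> Z \<Longrightarrow> f x y z < \<delta>"
          using * x by meson
        then have "S x y \<le> \<delta>"
          unfolding S_def using ne by (intro cSUP_least) (auto intro: less_imp_le)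
        then show "(INF y\<in>Y. S x y) \<le> 0 + \<delta>"
          using cINF_lower[OF bdd[OF x] y(1)] by simp
      qed
    qed (use I x in auto)
    then show "(SUP x\<in>X. INF y\<in>Y. S x y) = 0"
      using ne by (intro SUP_eq_0) auto
  qed
  then show ?thesis
    by (simp add: S_def)
qed

lemma monus_nonneg [simp]: "0 \<le> monus a b"
  by (simp add: monus_def)

lemma monus_eq_0_iff: "monus a b = 0 \<longleftrightarrow> a \<le> b"
  by (auto simp: monus_def max_def)

lemma theta_iff:
  assumes "carrier G \<noteq> {}" "P \<in> carrier G \<rightarrow> {0..1}"
  shows "theta G d P m k \<epsilon> \<longleftrightarrow>
    (\<forall>xs\<in>tuples (carrier G) m. \<forall>\<delta>>0. \<exists>x\<in>carrier G. \<forall>ys\<in>tuples (carrier G) k.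
      min (Min (insert 1 (P ` set ys)))
          (monus \<epsilon> (Min (insert 1 (d x ` words G xs ys)))) < \<delta>)"
proof -
  have ne: "tuples (carrier G) n \<noteq> {}" for n
    using assms(1) by (induction n) (auto simp: tuples_Suc)
  have "0 \<le> Min (insert 1 (P ` set ys))" if "ys \<in> tuples (carrier G) k" for ys
    using that assms(2) by (subst Min_ge_iff) (auto simp: tuples_def)
  moreover have "Min (insert 1 (P ` set ys)) \<le> 1" for ys
    by simp
  ultimately show ?thesis
    unfolding theta_def
    by (intro SUP_INF_SUP_eq_0_iff[where c = 1] ne assms) (auto simp: min.coboundedI1)
qed

lemma finite_words: "finite (words G xs ys)"
proof (induction ys)
  case (Cons y ys)
  have "words G xs (y # ys) = (\<lambda>(x, g). (x \<otimes>\<^bsub>G\<^esub> y) \<otimes>\<^bsub>G\<^esub> g) ` (set xs \<times> words G xs ys)"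
    by (auto simp: words_Cons)
  then show ?case
    using Cons by simp
qed simp

section \<open>Expansions built from a dyadic neighbourhood, and the converse\<close>

context metric_group
begin

lemma inf_dist_inv:
  assumes "A \<subseteq> carrier G" "(\<lambda>x. inv x) ` A = A" "x \<in> carrier G"
  shows "inf_dist d A (inv x) = inf_dist d A x"
proof -
  have "(\<lambda>a. d (inv x) a) ` A = (\<lambda>a. d (inv x) a) ` (\<lambda>x. inv x) ` A"
    by (simp only: assms(2))
  also have "\<dots> = (\<lambda>a. d x a) ` A"
    unfolding image_image using assms dist_inv[of x] by (intro image_cong) auto
  finally show ?thesis
    by (simp add: inf_dist_def)
qed

lemma inv_image_dyadic_nhd:
  "(\<lambda>x. inv x) ` dyadic_nhd (carrier G) d \<one> c = dyadic_nhd (carrier G) d \<one> c"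
proof -
  have *: "inv z \<in> dyadic_nhd (carrier G) d \<one> c" if "z \<in> dyadic_nhd (carrier G) d \<one> c" for z
    using that dyadic_chain_isometry[of "\<lambda>x. inv x" "carrier G" d \<one> z c]
    by (auto simp: dyadic_nhd_def dist_inv)
  have "z \<in> (\<lambda>x. inv x) ` dyadic_nhd (carrier G) d \<one> c" if "z \<in> dyadic_nhd (carrier G) d \<one> c" for z
    using *[OF that] that dyadic_nhd_subset[of \<one> c] by (intro image_eqI[of _ _ "inv z"]) auto
  with * show ?thesis
    by auto
qed

lemma inv_image_Compl:
  assumes "A \<subseteq> carrier G" "(\<lambda>x. inv x) ` A = A"
  shows "(\<lambda>x. inv x) ` (carrier G - A) = carrier G - A"
proof -
  have "inv x \<in> carrier G - A" if "x \<in> carrier G - A" for x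
  proof -
    have "inv (inv x) \<in> A" if "inv x \<in> A"
      using assms(2) that by blast
    then show ?thesis
      using that by auto
  qed
  moreover have "x = inv (inv x)" if "x \<in> carrier G - A" for x
    using that by simp
  ultimately show ?thesis
    by blast
qed

text \<open>The slack \<open>2\<epsilon>\<close> in the last axiom of \<open>K_grey\<close> allows a sixteenfold enlargement of \<open>d\<close>-radii,
and only a fivefold one is needed.\<close>

lemma K_grey_dyadic:
  fixes r :: real
  defines "U \<equiv> dyadic_nhd (carrier G) d \<one> (r / 16)"
  assumes r: "0 < r" and far: "x0 \<in> carrier G" "r \<le> d \<one> x0"
  shows "K_grey G (snowflake d r) (\<lambda>x. min (1/2) (inf_dist (snowflake d r) (carrier G - U) x))
      (\<lambda>x. min (1/2) (inf_dist (snowflake d r) U x))"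
    (is "K_grey G ?d ?P ?Q")
proof -
  interpret S: metric_group G ?d
    using r by (rule metric_group_snowflake)
  \<comment> \<open>The radius \<open>r / 16 = r * (1/2) ^ 4\<close> corresponds to
    \<open>1/2\<close> in the new metric. So \<open>P\<close> reaches \<open>1/2\<close> at
    \<open>\<one>\<close>, while \<open>U\<close> stays within \<open>r / 8\<close> of
    \<open>\<one>\<close>.\<close>
  have c: "0 < r / 16"
    using r by simp
  have U_sub: "U \<subseteq> carrier G" and one_U: "\<one> \<in> U"
    unfolding U_def using dyadic_nhd_subset centre_in_dyadic_nhd by auto
  have U_bdd: "d \<one> u < r / 8" if "u \<in> U" for u
    using dyadic_nhd_bounded[OF one_closed c] that unfolding U_def by force
  have C: "carrier G - U \<noteq> {}" "carrier G - U \<subseteq> carrier G"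
    using far U_bdd[of x0] r by force+
  have U_inv: "(\<lambda>x. inv x) ` U = U"
    unfolding U_def by (rule inv_image_dyadic_nhd)
  have P_inv: "?P (inv x) = ?P x" and Q_inv: "?Q (inv x) = ?Q x" if "x \<in> carrier G" for x
    using that U_sub U_inv by (simp_all add: S.inf_dist_inv inv_image_Compl)
  have P01: "0 \<le> ?P x" and Q01: "0 \<le> ?Q x" for x
    using S.inf_dist_nonneg C(1) one_U by (auto simp: min_def)
  have snow_ge: "\<epsilon> \<le> ?d x y" if "r * \<epsilon> ^ 4 \<le> d x y" "0 < \<epsilon>" "\<epsilon> \<le> 1" for \<epsilon> x y
    using snowflake_less_iff[OF r that(2,3), of d x y] that(1) by linarith
  have P_ge: "\<epsilon> \<le> ?P y" if "mball y (r * \<epsilon> ^ 4) \<subseteq> U" "y \<in> carrier G" "0 < \<epsilon>" "\<epsilon> \<le> 1/2" for \<epsilon> y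
  proof -
    have "\<epsilon> \<le> inf_dist ?d (carrier G - U) y"
    proof (rule inf_dist_geI[OF C(1)])
      fix a assume "a \<in> carrier G - U"
      with that(1,2) have "\<not> d y a < r * \<epsilon> ^ 4"
        by auto
      then show "\<epsilon> \<le> ?d y a"
        using that by (intro snow_ge) auto
    qed
    with that show ?thesis
      by simp
  qed
  have P_one: "?P \<one> = 1/2"
  proof -
    have "mball \<one> (r * (1/2) ^ 4) \<subseteq> U"
      using mball_subset_dyadic_nhd[of \<one> \<one> "r / 16" 0]
      by (simp add: U_def power4_eq_xxxx)
    then have "1/2 \<le> ?P \<one>"
      using P_ge[of \<one> "1/2"] by simp
    then show ?thesis
      by simp
  qed
  have Q_far: "?Q x0 = 1/2"
  proof -
    \<comment> \<open>Since \<open>x0\<close> is at least \<open>r\<close> away from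
      \<open>\<one>\<close>, at least \<open>7 * r / 8\<close> remains between \<open>x0\<close> and
      \<open>U\<close>, well above the \<open>r / 16\<close> that corresponds to
      \<open>1/2\<close>.\<close>
    have "1/2 \<le> inf_dist ?d U x0"
    proof (rule inf_dist_geI)
      fix u assume u: "u \<in> U"
      then have "r \<le> d \<one> u + d x0 u"
        using triangle[of \<one> u x0] far U_sub by (force simp: commute)
      then have "r / 16 \<le> d x0 u"
        using U_bdd[OF u] r by linarith
      then show "1/2 \<le> ?d x0 u"
        by (intro snow_ge) (auto simp: power4_eq_xxxx)
    qed (use one_U in auto)
    then show ?thesis
      by simp
  qed
  have P_0: "?P x = 0" if "x \<in> carrier G - U" for x
    using that C by (simp add: S.inf_dist_eq_0)
  have Q_0: "?Q x = 0" if "x \<in> U" for x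
    using that U_sub by (simp add: S.inf_dist_eq_0)
  have last: "(SUP x\<in>carrier G. min (monus \<epsilon> (?Q x))
        (INF y\<in>carrier G. max (monus (?d x y) (2 * \<epsilon>)) (monus \<epsilon> (?P y)))) = 0"
    if \<epsilon>: "\<epsilon> \<in> {0..1/2}" for \<epsilon>
  proof (rule SUP_eq_0)
    fix x assume x: "x \<in> carrier G"
    have nonneg: "0 \<le> (INF y\<in>carrier G. max (monus (?d x y) (2 * \<epsilon>)) (monus \<epsilon> (?P y)))"
      by (intro cINF_greatest) (auto simp: le_max_iff_disj)
    show "min (monus \<epsilon> (?Q x))
        (INF y\<in>carrier G. max (monus (?d x y) (2 * \<epsilon>)) (monus \<epsilon> (?P y))) = 0"
    proof (cases "\<epsilon> \<le> ?Q x")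
      case True
      then have "monus \<epsilon> (?Q x) = 0"
        by (simp only: monus_eq_0_iff)
      with nonneg show ?thesis
        by simp
    next
      case False
      then have "0 < \<epsilon>"
        using Q01[of x] by linarith
      from False \<epsilon> have "inf_dist ?d U x < \<epsilon>"
        by (auto simp: min_def split: if_splits)
      then obtain u where u: "u \<in> U" "?d x u < \<epsilon>"
        using S.inf_dist_lessE[of U x \<epsilon>] one_U by blast
      define \<rho> where "\<rho> = r * \<epsilon> ^ 4"
      \<comment> \<open>This keeps \<open>\<rho>\<close> below \<open>r / 16\<close>, the largest
        radius for which inner balls of \<open>U\<close> are available.\<close>
      have "\<epsilon> ^ 4 \<le> (1/2) ^ 4"
        using \<epsilon> by (intro power_mono) auto
      then have \<rho>: "0 < \<rho>" "\<rho> \<le> r / 16"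
        using r \<open>0 < \<epsilon>\<close> by (simp_all add: \<rho>_def power4_eq_xxxx)
      obtain y where y: "y \<in> carrier G" "d u y < 4 * \<rho>" "mball y \<rho> \<subseteq> U"
        using dyadic_nhd_inner_ball[OF one_closed c u(1)[unfolded U_def] \<rho>] unfolding U_def
        by blast
      \<comment> \<open>One \<open>\<rho>\<close> leads from \<open>x\<close> to \<open>U\<close>
        and four more lead to the centre \<open>y\<close> of an inner ball; the total of five is
        below the 16 that \<open>2 * \<epsilon>\<close> allows.\<close>
      have "d x u < \<rho>"
        using u(2) snowflake_less_iff[OF r \<open>0 < \<epsilon>\<close>, of d x u] \<epsilon> by (simp add: \<rho>_def)
      then have "d x y < 5 * \<rho>"
        using triangle[of x u y] x y u(1) U_sub by force
      also have "5 * \<rho> \<le> r * (2 * \<epsilon>) ^ 4"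
        using \<rho>(1) by (simp add: \<rho>_def power_mult_distrib)
      finally have "?d x y < 2 * \<epsilon>"
        using snowflake_less_iff[OF r, of "2 * \<epsilon>" d x y] \<epsilon> \<open>0 < \<epsilon>\<close> by simp
      moreover have "\<epsilon> \<le> ?P y"
        using y \<epsilon> \<open>0 < \<epsilon>\<close> by (intro P_ge) (auto simp: \<rho>_def)
      ultimately have "max (monus (?d x y) (2 * \<epsilon>)) (monus \<epsilon> (?P y)) = 0"
        unfolding monus_def by linarith
      then have "(INF y\<in>carrier G. max (monus (?d x y) (2 * \<epsilon>)) (monus \<epsilon> (?P y))) = 0"
        using y(1) by (intro INF_eq_0[of _ _ y]) (auto simp: le_max_iff_disj)
      then show ?thesis
        by simp
    qed
  qed auto
  show ?thesis
    unfolding K_grey_def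
  proof (intro conjI ballI)
    show "has_modulus (carrier G) ?d id ?P" "has_modulus (carrier G) ?d id ?Q"
      using S.has_modulus_inf_dist U_sub C one_U by blast+
    show "(SUP x\<in>carrier G. \<bar>?P x - ?P (inv x)\<bar>) = 0" "(SUP x\<in>carrier G. \<bar>?Q x - ?Q (inv x)\<bar>) = 0"
      by (intro SUP_eq_0; (simp add: P_inv Q_inv | blast))+
    show "(INF x\<in>carrier G. \<bar>?P x - 1/2\<bar>) = 0"
      by (rule INF_eq_0[of _ _ \<one>]) (use P_one in auto)
    show "(INF x\<in>carrier G. \<bar>?Q x - 1/2\<bar>) = 0"
      by (rule INF_eq_0[of _ _ x0]) (use Q_far far in auto)
    show "(SUP x\<in>carrier G. min (?P x) (?Q x)) = 0"
    proof (rule SUP_eq_0)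
      fix x assume "x \<in> carrier G"
      then have "?P x = 0 \<or> ?Q x = 0"
        using P_0 Q_0 by blast
      then show "min (?P x) (?Q x) = 0"
        using P01[of x] Q01[of x] by linarith
    qed auto
    show "?d x y \<in> {0..1}" for x y
      using S.nonneg snowflake_le_1 by auto
  qed (use S.metric_group_axioms P01 Q01 Q_0[OF one_U] last in auto)
qed

text \<open>\<open>P\<close> is positive only on \<open>U\<close>, hence only inside the ball of
  radius \<open>r\<close>. The words with all \<open>P y\<close> positive therefore avoid the
  \<open>r\<close>-ball around a suitable point, and \<open>d\<close>-distance at least
  \<open>r\<close> becomes the maximal value 1 of the new metric.\<close>

lemma chain_unbounded_imp_grey:
  assumes "0 < r" "chain_unbounded (carrier G) d r"
  shows "\<exists>d' P Q. grey_expansion G d d' P Q \<and> (\<forall>m k. theta G d' P m k 1)"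
proof -
  let ?U = "dyadic_nhd (carrier G) d \<one> (r / 16)"
  let ?d = "snowflake d r"
  let ?P = "\<lambda>x. min (1/2) (inf_dist ?d (carrier G - ?U) x)"
  let ?Q = "\<lambda>x. min (1/2) (inf_dist ?d ?U x)"
  \<comment> \<open>Already one step from \<open>\<one>\<close> fails to reach everything; a missed
    point is at distance at least \<open>r\<close> and lets \<open>Q\<close> attain
    \<open>1/2\<close>.\<close>
  obtain x0 where x0: "x0 \<in> carrier G" "x0 \<notin> (step_rel (carrier G) d r ^^ 1) `` {\<one>}"
    by (rule chain_unboundedE[OF assms(2), of "{\<one>}" 1]) auto
  then have "r \<le> d \<one> x0"
    by (auto simp: step_rel_def)
  then have grey: "K_grey G ?d ?P ?Q"
    using assms(1) x0(1) by (intro K_grey_dyadic)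
  interpret S: metric_group G ?d
    using assms(1) by (rule metric_group_snowflake)
  have U_sub: "?U \<subseteq> mball \<one> r"
    using dyadic_nhd_bounded[OF one_closed, of "r / 16"] assms(1) dyadic_nhd_subset[of \<one> "r / 16"]
    by (fastforce simp: subset_iff)
  have P_pos: "y \<in> mball \<one> r" if "y \<in> carrier G" "0 < ?P y" for y
  proof (rule ccontr)
    assume "y \<notin> mball \<one> r"
    then have "y \<in> carrier G - ?U"
      using U_sub that by auto
    then show False
      using that S.inf_dist_eq_0[of "carrier G - ?U" y] by simp
  qed
  have "theta G ?d ?P m k 1" for m k
  proof (subst theta_iff)
    show "\<forall>xs\<in>tuples (carrier G) m. \<forall>\<delta>>0. \<exists>x\<in>carrier G. \<forall>ys\<in>tuples (carrier G) k.
      min (Min (insert 1 (?P ` set ys))) (monus 1 (Min (insert 1 (?d x ` words G xs ys)))) < \<delta>"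
    proof (intro ballI allI impI)
      fix xs and \<delta> :: real
      assume xs: "xs \<in> tuples (carrier G) m" and "0 < \<delta>"
      then obtain g where g: "g \<in> carrier G"
        "distant_from d r g (set_power G (set xs <#> mball \<one> r) k)"
        using chain_unbounded_imp_distant[OF assms(2), of "set xs" k] by (auto simp: tuples_def)
      have "min (Min (insert 1 (?P ` set ys))) (monus 1 (Min (insert 1 (?d g ` words G xs ys)))) < \<delta>"
        if ys: "ys \<in> tuples (carrier G) k" for ys
      proof (cases "\<forall>y\<in>set ys. 0 < ?P y")
        case True
        then have "ys \<in> tuples (mball \<one> r) k"
          using ys P_pos unfolding tuples_def by blast
        then have "r \<le> d g w" if "w \<in> words G xs ys" for w
          using that g(2) unfolding distant_from_def set_power_eq_words by blast
        then have "1 \<le> ?d g w" if "w \<in> words G xs ys" for w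
          using that snowflake_less_iff[OF assms(1), of 1 d g w] by force
        then have "1 \<le> Min (insert 1 (?d g ` words G xs ys))"
          by (subst Min_ge_iff) (auto simp: finite_words)
        then have "monus 1 (Min (insert 1 (?d g ` words G xs ys))) = 0"
          by (simp only: monus_eq_0_iff)
        then show ?thesis
          using \<open>0 < \<delta>\<close> by (simp add: min_less_iff_disj)
      next
        case False
        then obtain y where "y \<in> set ys" "?P y \<le> 0"
          by force
        then have "Min (insert 1 (?P ` set ys)) \<le> 0"
          by (subst Min_le_iff) auto
        then show ?thesis
          using \<open>0 < \<delta>\<close> by (simp only: min_less_iff_disj) linarith
      qed
      with g(1) show "\<exists>x\<in>carrier G. \<forall>ys\<in>tuples (carrier G) k.
        min (Min (insert 1 (?P ` set ys))) (monus 1 (Min (insert 1 (?d x ` words G xs ys)))) < \<delta>"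
        by blast
    qed
    show "?P \<in> carrier G \<rightarrow> {0..1}"
      using grey by (simp add: K_grey_def)
  qed auto
  moreover have "grey_expansion G d ?d ?P ?Q"
    using grey assms(1) by (simp add: grey_expansion_def mtopology_snowflake)
  ultimately show ?thesis
    by blast
qed

text \<open>If chains covered the group, the point \<open>x\<close> supplied by \<open>theta\<close>
  would itself be a word whose factors \<open>y\<close> all satisfy \<open>1/4 \<le> P y\<close>. At
  this word the inner minimum is at least \<open>min (1/4) \<epsilon>\<close>, contrary to the
  tolerance with which \<open>x\<close> was chosen.\<close>

lemma grey_imp_chain_unbounded:
  assumes grey: "grey_expansion G d d' P Q"
    and theta: "\<And>m k. \<exists>\<epsilon>>0. theta G d' P m k \<epsilon>"
  shows "\<exists>r>0. chain_unbounded (carrier G) d r"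
proof -
  have K: "K_grey G d' P Q" and top: "Metric_space.mtopology (carrier G) d' = mtopology"
    using grey by (auto simp: grey_expansion_def)
  interpret D: metric_group G d'
    using K by (simp add: K_grey_def)
  have P01: "P \<in> carrier G \<rightarrow> {0..1}" and "(INF x\<in>carrier G. \<bar>P x - 1/2\<bar>) < 1/8"
    and modulus: "has_modulus (carrier G) d' id P"
    using K by (simp_all add: K_grey_def)
  then obtain v where v: "v \<in> carrier G" "\<bar>P v - 1/2\<bar> < 1/8"
    by (subst (asm) cINF_less_iff) (auto intro!: bdd_belowI[of _ 0])
  \<comment> \<open>From \<open>1/2\<close>, one \<open>1/8\<close> is lost in the choice of
    \<open>v\<close> and one in the radius, which leaves \<open>1/4\<close>. The ball is taken in
    \<open>d'\<close>; the common topology then provides a \<open>d\<close>-ball inside it.\<close>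
  define V where "V = D.mball v (1/8)"
  have P_V: "1/4 \<le> P y" if "y \<in> V" for y
  proof -
    have "y \<in> carrier G" "d' v y < id (1/8)"
      using that by (simp_all add: V_def)
    moreover have "(1/8::real) \<in> {0<..1}"
      by simp
    ultimately have "\<bar>P v - P y\<bar> \<le> 1/8"
      using modulus v(1) unfolding has_modulus_def by blast
    then show ?thesis
      using v(2) by linarith
  qed
  have "openin mtopology V" "v \<in> V"
    using v(1) D.openin_mball[of v "1/8"] by (simp_all add: V_def top)
  then obtain r where r: "0 < r" "mball v r \<subseteq> V"
    unfolding openin_mtopology by blast
  have "\<not> carrier G \<subseteq> (step_rel (carrier G) d r ^^ k) `` F" if F: "finite F" "F \<subseteq> carrier G" for F k
  proof
    assume cover: "carrier G \<subseteq> (step_rel (carrier G) d r ^^ k) `` F"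
    let ?F = "(\<lambda>f. f \<otimes> inv v) ` insert \<one> F"
    obtain xs where xs: "set xs = ?F"
      using F(1) finite_list[of ?F] by auto
    obtain \<epsilon> where "0 < \<epsilon>" and "theta G d' P (length xs) (Suc k) \<epsilon>"
      using theta by blast
    moreover have "xs \<in> tuples (carrier G) (length xs)"
      using xs F v(1) by (auto simp: tuples_def)
    moreover have "0 < min (1/4) \<epsilon>"
      using \<open>0 < \<epsilon>\<close> by simp
    moreover have "carrier G \<noteq> {}"
      by auto
    ultimately obtain x where x: "x \<in> carrier G"
      and small: "\<And>ys. ys \<in> tuples (carrier G) (Suc k) \<Longrightarrow>
        min (Min (insert 1 (P ` set ys))) (monus \<epsilon> (Min (insert 1 (d' x ` words G xs ys))))
          < min (1/4) \<epsilon>"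
      unfolding theta_iff[OF \<open>carrier G \<noteq> {}\<close> P01] by meson
    have "x \<in> set_power G (set xs <#> V) (Suc k)"
      using chain_subset_set_power[OF F(2) v(1) r(2,1), of k] cover x xs by auto
    then obtain ys where ys: "ys \<in> tuples V (Suc k)" "x \<in> words G xs ys"
      unfolding set_power_eq_words by blast
    have "V \<subseteq> carrier G"
      by (auto simp: V_def)
    then have "ys \<in> tuples (carrier G) (Suc k)"
      using ys(1) by (auto simp: tuples_def)
    note small[OF this]
    moreover have "1/4 \<le> Min (insert 1 (P ` set ys))"
      using ys(1) P_V by (subst Min_ge_iff) (auto simp: tuples_def)
    moreover have "Min (insert 1 (d' x ` words G xs ys)) \<le> d' x x"
      using ys(2) finite_words by (intro Min_le) auto
    then have "\<epsilon> \<le> monus \<epsilon> (Min (insert 1 (d' x ` words G xs ys)))"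
      using x by (simp add: monus_def)
    ultimately show False
      by linarith
  qed
  then show ?thesis
    using r(1) by (auto simp: chain_unbounded_def)
qed

end

section \<open>Equivalence with the existence of a grey expansion\<close>

theorem uniformly_non_OB_iff_grey:
  assumes "metric_group G d"
  shows "uniformly_non_OB G d \<longleftrightarrow>
    (\<exists>s :: nat \<times> nat \<Rightarrow> nat. (\<forall>m k. s (m, k) > 0) \<and>
      (\<exists>d' P Q. grey_expansion G d d' P Q \<and>
        (\<forall>m k. theta G d' P m k (1 / real (s (m, k))))))"
proof -
  interpret metric_group G d by fact
  show ?thesis
    unfolding uniformly_non_OB_iff
  proof (intro iffI conjI assms)
    assume "metric_group G d \<and> (\<exists>r>0. chain_unbounded (carrier G) d r)"
    then show "\<exists>s :: nat \<times> nat \<Rightarrow> nat. (\<forall>m k. s (m, k) > 0) \<and>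
      (\<exists>d' P Q. grey_expansion G d d' P Q \<and>
        (\<forall>m k. theta G d' P m k (1 / real (s (m, k)))))"
      \<comment> \<open>The constructed expansion satisfies every \<open>theta\<close> with constant
        1, so \<open>s\<close> can be constant.\<close>
      using chain_unbounded_imp_grey by (intro exI[of _ "\<lambda>_. 1"]) auto
  next
    assume "\<exists>s :: nat \<times> nat \<Rightarrow> nat. (\<forall>m k. s (m, k) > 0) \<and>
      (\<exists>d' P Q. grey_expansion G d d' P Q \<and>
        (\<forall>m k. theta G d' P m k (1 / real (s (m, k)))))"
    then obtain s d' P Q where s: "\<And>m k. s (m, k) > (0::nat)" and "grey_expansion G d d' P Q"
      and "\<And>m k. theta G d' P m k (1 / real (s (m, k)))"
      by blast
    \<comment> \<open>Positivity of \<open>s\<close> rules out \<open>1 / 0 = 0\<close>, a constant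
      for which \<open>theta\<close> would be vacuous.\<close>
    moreover from this have "\<exists>\<epsilon>>0. theta G d' P m k \<epsilon>" for m k
      using s by (intro exI[of _ "1 / real (s (m, k))"]) auto
    ultimately show "\<exists>r>0. chain_unbounded (carrier G) d r"
      using grey_imp_chain_unbounded by blast
  qed
qed

section \<open>Density characters\<close>

lemma Cinfinite_natLeq_csum: "Cinfinite (natLeq +c r)"
  by (rule Cinfinite_csum1) (rule natLeq_Cinfinite)

lemma natLeq_csum_least:
  assumes "Cinfinite r" "|A| \<le>o r"
  shows "natLeq +c |A| \<le>o r"
  using assms natLeq_ordLeq_cinfinite[OF assms(1)]
  by (intro csum_cinfinite_bound natLeq_Card_order card_of_Card_order) auto

lemma card_of_le_natLeq_csum: "|A| \<le>o natLeq +c |A|"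
  by (rule ordLeq_csum2) (rule card_of_Card_order)

text \<open>Cardinals are well-ordered, so the choice in \<open>density_character\<close> does
  denote a dense set of least cardinality.\<close>

lemma density_characterE:
  obtains D where "dense_subset T D" "density_character T = natLeq +c |D|"
    "\<And>D'. dense_subset T D' \<Longrightarrow> |D| \<le>o |D'|"
proof -
  have "dense_subset T (topspace T)"
    by (simp add: dense_subset_def)
  then have "|topspace T| \<in> {|D| | D. dense_subset T D}"
    by blast
  then obtain z where z: "z \<in> {|D| | D. dense_subset T D}"
    and "\<And>y. (y, z) \<in> ordLess \<Longrightarrow> y \<notin> {|D| | D. dense_subset T D}"
    by (rule wfE_min[OF wf_ordLess]) blast
  then obtain D where D: "dense_subset T D" "\<And>D'. dense_subset T D' \<Longrightarrow> \<not> |D'| <o |D|"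
    by blast
  then have "dense_subset T D \<and> (\<forall>D'. dense_subset T D' \<longrightarrow> |D| \<le>o |D'| )"
    by (meson card_of_Well_order not_ordLess_iff_ordLeq)
  from someI[of "\<lambda>D. dense_subset T D \<and> (\<forall>D'. dense_subset T D' \<longrightarrow> |D| \<le>o |D'| )", OF this] that
  show ?thesis
    unfolding density_character_def by blast
qed

lemma density_character_le:
  assumes "dense_subset T D"
  shows "density_character T \<le>o natLeq +c |D|"
  by (rule density_characterE[of T]) (metis assms csum_mono2)

lemma (in Metric_space) dense_subset_iff:
  "dense_subset mtopology D \<longleftrightarrow> D \<subseteq> M \<and> (\<forall>x\<in>M. \<forall>\<epsilon>>0. \<exists>y\<in>D. d x y < \<epsilon>)"
proof -
  have "mtopology closure_of D = M \<longleftrightarrow> M \<subseteq> mtopology closure_of D"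
    using closure_of_subset_topspace[of mtopology D] by auto
  also have "\<dots> \<longleftrightarrow> (\<forall>x\<in>M. \<forall>\<epsilon>>0. \<exists>y\<in>D. d x y < \<epsilon>)" if "D \<subseteq> M"
    using that unfolding metric_closure_of in_mball by blast
  finally show ?thesis
    unfolding dense_subset_def by auto
qed

text \<open>Density is hereditary for metric spaces: for each \<open>y\<close> in a dense set and
  each \<open>n\<close>, pick a point of \<open>A\<close> within \<open>1 / Suc n\<close> of
  \<open>y\<close> if there is one. The picked points are dense in \<open>A\<close>, and the factor
  \<open>nat\<close> is absorbed by the infinite cardinal.\<close>

lemma (in Metric_space) density_character_mono:
  assumes "A \<subseteq> M"
  shows "density_character (Metric_space.mtopology A d) \<le>o density_character mtopology"
proof -
  interpret A: Metric_space A d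
    using assms by (rule subspace)
  obtain D where D: "dense_subset mtopology D" and dens: "density_character mtopology = natLeq +c |D|"
    by (rule density_characterE)
  let ?r = "natLeq +c |D|"
  define near where "near = (\<lambda>(y, n::nat) x. x \<in> A \<and> d x y < 1 / Suc n)"
  define pick where "pick p = (SOME x. near p x)" for p
  have pick: "near p (pick p)" if "near p x" for p x
    unfolding pick_def using that by (rule someI)
  define B where "B = pick ` {p \<in> D \<times> UNIV. \<exists>x. near p x}"
  have "dense_subset A.mtopology B"
    unfolding A.dense_subset_iff
  proof (intro conjI ballI allI impI)
    show "B \<subseteq> A"
      using pick by (fastforce simp: B_def near_def)
    fix x and \<epsilon> :: real
    assume x: "x \<in> A" and "0 < \<epsilon>"
    then obtain n where n: "1 / Suc n < \<epsilon> / 2"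
      using nat_approx_posE[of "\<epsilon> / 2"] by auto
    have "0 < 1 / real (Suc n)"
      by simp
    then obtain y where y: "y \<in> D" "d x y < 1 / Suc n"
      using D x assms unfolding dense_subset_iff by blast
    then have near: "near (y, n) x"
      using x by (simp add: near_def)
    then have "near (y, n) (pick (y, n))"
      by (rule pick)
    then have z: "pick (y, n) \<in> A" "d (pick (y, n)) y < 1 / Suc n"
      by (auto simp: near_def)
    have "x \<in> M" "y \<in> M" "pick (y, n) \<in> M"
      using x y(1) z(1) D assms unfolding dense_subset_iff by blast+
    then have "d x (pick (y, n)) < \<epsilon>"
      using triangle[of x y "pick (y, n)"] y(2) z(2) n commute[of y "pick (y, n)"] by linarith
    moreover have "pick (y, n) \<in> B"
      using near y(1) by (auto simp: B_def)
    ultimately show "\<exists>y\<in>B. d x y < \<epsilon>"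
      by blast
  qed
  then have "density_character A.mtopology \<le>o natLeq +c |B|"
    by (rule density_character_le)
  also have "natLeq +c |B| \<le>o ?r"
  proof (rule natLeq_csum_least[OF Cinfinite_natLeq_csum])
    have "|B| \<le>o |D \<times> (UNIV :: nat set)|"
      unfolding B_def
      by (rule ordLeq_transitive[OF card_of_image card_of_mono1]) auto
    also have "|D \<times> (UNIV :: nat set)| \<le>o ?r"
    proof (rule card_of_Times_ordLeq_infinite_Field)
      show "\<not> finite (Field ?r)" "Card_order ?r"
        using Cinfinite_natLeq_csum[of "|D|"] by (auto simp: cinfinite_def)
      show "|UNIV :: nat set| \<le>o ?r"
        using card_of_nat ordLeq_csum1[OF natLeq_Card_order] by (rule ordIso_ordLeq_trans)
    qed (rule card_of_le_natLeq_csum)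
    finally show "|B| \<le>o ?r" .
  qed
  finally show ?thesis
    by (simp only: dens)
qed

section \<open>Small subgroups\<close>

text \<open>Close \<open>S\<close> under \<open>x \<otimes> inv y\<close> in countably many stages.
  Each stage at most squares the cardinality, and \<open>r\<close> absorbs squares and countable
  unions. The stages increase because all of them contain \<open>\<one>\<close>.\<close>

lemma (in group) ex_small_subgroup:
  assumes S: "S \<subseteq> carrier G" "|S| \<le>o r" and r: "Cinfinite r"
  obtains L where "subgroup L G" "S \<subseteq> L" "|L| \<le>o r"
proof -
  define X where "X = rec_nat (insert \<one> S) (\<lambda>_ Y. (\<lambda>(x, y). x \<otimes> inv y) ` (Y \<times> Y))"
  have X0: "X 0 = insert \<one> S" and XS: "X (Suc n) = (\<lambda>(x, y). x \<otimes> inv y) ` (X n \<times> X n)" for n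
    by (simp_all add: X_def)
  have inf: "\<not> finite (Field r)" "Card_order r"
    using r by (auto simp: cinfinite_def)
  have X: "X n \<subseteq> carrier G \<and> \<one> \<in> X n \<and> |X n| \<le>o r" for n
  proof (induction n)
    case 0
    have "countable {\<one>}"
      by simp
    then have "|{\<one>}| \<le>o r"
      unfolding countable_card_le_natLeq
      using natLeq_ordLeq_cinfinite[OF r] by (rule ordLeq_transitive)
    then have "|{\<one>} \<union> S| \<le>o r"
      using S(2) inf by (intro card_of_Un_ordLeq_infinite_Field)
    then show ?case
      using S(1) by (simp add: X0)
  next
    case (Suc n)
    have "|X n \<times> X n| \<le>o r"
      using Suc inf by (intro card_of_Times_ordLeq_infinite_Field) auto
    then have "|X (Suc n)| \<le>o r"
      unfolding XS by (rule ordLeq_transitive[OF card_of_image])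
    moreover have "\<one> \<in> X (Suc n)"
      unfolding XS using Suc by (intro image_eqI[of _ _ "(\<one>, \<one>)"]) auto
    moreover have "X (Suc n) \<subseteq> carrier G"
      unfolding XS using Suc by auto
    ultimately show ?case
      by blast
  qed
  have X_mono: "X m \<subseteq> X n" if "m \<le> n" for m n
  proof (rule lift_Suc_mono_le[OF _ that])
    fix n
    show "X n \<subseteq> X (Suc n)"
    proof
      fix x assume "x \<in> X n"
      then show "x \<in> X (Suc n)"
        unfolding XS using X[of n] by (intro image_eqI[of _ _ "(x, \<one>)"]) auto
    qed
  qed
  define L where "L = (\<Union>n. X n)"
  have L_div: "x \<otimes> inv y \<in> L" if xy: "x \<in> L" "y \<in> L" for x y
  proof -
    obtain m n where "x \<in> X m" "y \<in> X n"
      using xy unfolding L_def by blast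
    then have "(x, y) \<in> X (max m n) \<times> X (max m n)"
      using X_mono[of m "max m n"] X_mono[of n "max m n"] by auto
    then have "x \<otimes> inv y \<in> X (Suc (max m n))"
      unfolding XS by force
    then show ?thesis
      unfolding L_def by blast
  qed
  have L_sub: "L \<subseteq> carrier G" and one_L: "\<one> \<in> L"
    using X by (auto simp: L_def)
  have L_inv: "inv x \<in> L" if "x \<in> L" for x
    using L_div[OF one_L that] that L_sub by auto
  have "x \<otimes> y \<in> L" if "x \<in> L" "y \<in> L" for x y
    using L_div[OF that(1) L_inv[OF that(2)]] that L_sub by auto
  then have "subgroup L G"
    using L_sub one_L L_inv by (intro subgroupI) auto
  moreover have "S \<subseteq> L"
    using X0 unfolding L_def by blast
  moreover have "|L| \<le>o r"
    unfolding L_def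
  proof (rule card_of_UNION_ordLeq_infinite_Field[OF inf])
    show "|UNIV :: nat set| \<le>o r"
      using card_of_nat natLeq_ordLeq_cinfinite[OF r] by (rule ordIso_ordLeq_trans)
  qed (use X in auto)
  ultimately show ?thesis
    by (rule that)
qed

section \<open>Closures of subgroups and completeness\<close>

context metric_group
begin

lemma subgroup_closure:
  assumes "subgroup L G"
  shows "subgroup (mtopology closure_of L) G"
proof (rule subgroupI)
  have L: "L \<subseteq> carrier G"
    using assms by (rule subgroup.subset)
  show "mtopology closure_of L \<subseteq> carrier G"
    by (auto simp: metric_closure_of)
  show "mtopology closure_of L \<noteq> {}"
    using closure_of_subset[of L mtopology] L subgroup.one_closed[OF assms] by auto
  show "inv x \<in> mtopology closure_of L" if x: "x \<in> mtopology closure_of L" for x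
    unfolding metric_closure_of
  proof (intro CollectI conjI allI impI)
    show "inv x \<in> carrier G"
      using x by (auto simp: metric_closure_of)
    fix \<epsilon> :: real assume "0 < \<epsilon>"
    then obtain a where a: "a \<in> L" "a \<in> mball x \<epsilon>"
      using x by (auto simp: metric_closure_of)
    then show "\<exists>y\<in>L. y \<in> mball (inv x) \<epsilon>"
      using subgroup.m_inv_closed[OF assms] by (intro bexI[of _ "inv a"]) (auto simp: dist_inv)
  qed
  show "x \<otimes> y \<in> mtopology closure_of L"
    if xy: "x \<in> mtopology closure_of L" "y \<in> mtopology closure_of L" for x y
    unfolding metric_closure_of
  proof (intro CollectI conjI allI impI)
    show "x \<otimes> y \<in> carrier G"
      using xy by (auto simp: metric_closure_of)
    fix \<epsilon> :: real assume "0 < \<epsilon>"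
    then have "0 < \<epsilon> / 2"
      by simp
    then obtain a b where a: "a \<in> L" "a \<in> mball x (\<epsilon> / 2)" and b: "b \<in> L" "b \<in> mball y (\<epsilon> / 2)"
      using xy unfolding metric_closure_of by blast
    then have "d (x \<otimes> y) (a \<otimes> b) < \<epsilon>"
      using dist_mult_le[of x y a b] by auto
    then show "\<exists>c\<in>L. c \<in> mball (x \<otimes> y) \<epsilon>"
      using a b subgroup.m_closed[OF assms] by (intro bexI[of _ "a \<otimes> b"]) auto
  qed
qed

lemma metric_group_closed_subgroup:
  assumes "subgroup K G" "closedin mtopology K"
  shows "metric_group (G\<lparr>carrier := K\<rparr>) d"
proof -
  have K: "K \<subseteq> carrier G"
    using assms(1) by (rule subgroup.subset)
  interpret K: Submetric "carrier G" d K
    using K by unfold_locales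
  show ?thesis
  proof (intro metric_group.intro metric_group_axioms.intro)
    show "group (G\<lparr>carrier := K\<rparr>)"
      using assms(1) group_axioms by (rule subgroup.subgroup_is_group)
    show "Metric_space (carrier (G\<lparr>carrier := K\<rparr>)) d"
      using K.sub.Metric_space_axioms by simp
    show "Metric_space.mcomplete (carrier (G\<lparr>carrier := K\<rparr>)) d"
      using K.closedin_mcomplete_imp_mcomplete[OF assms(2) complete] by simp
  qed (use K left_invariant right_invariant in \<open>auto simp: subset_iff\<close>)
qed

end

section \<open>Unbounded closed subgroups\<close>

text \<open>Greedy choice: the finitely many earlier terms do not reach everything in
  \<open>k\<close> steps, so a further term exists.\<close>

lemma (in Metric_space) ex_separated_sequence:
  assumes "chain_unbounded M d r"
  shows "\<exists>e :: nat \<Rightarrow> 'a. range e \<subseteq> M \<and> (\<forall>i j. i < j \<longrightarrow> (e i, e j) \<notin> step_rel M d r ^^ k)"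
proof -
  let ?P = "\<lambda>e n a. a \<in> M \<and> (\<forall>i<n. (e i, a) \<notin> step_rel M d r ^^ k)"
  have "\<exists>e. \<forall>n::nat. ?P e n (e n)"
  proof (rule dependent_wellorder_choice)
    fix n :: nat and e assume IH: "\<And>i. i < n \<Longrightarrow> ?P e i (e i)"
    have "e ` {..<n} \<subseteq> M"
      using IH by auto
    with chain_unboundedE[OF assms, of "e ` {..<n}" k] show "\<exists>a. ?P e n a"
      by (metis ImageI finite_imageI finite_lessThan imageI lessThan_iff)
  qed auto
  then show ?thesis
    by blast
qed

text \<open>By the pigeonhole principle, an infinite set that is separated for \<open>2k\<close> steps is not covered
by the \<open>k\<close> step neighbourhood of a finite set, and the same is true in every subset containing it.\<close>

lemma (in Metric_space) chain_unbounded_subset: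
  fixes e :: "nat \<Rightarrow> nat \<Rightarrow> 'a"
  assumes "K \<subseteq> M"
    and e: "\<And>k. range (e k) \<subseteq> K" "\<And>k i j. i < j \<Longrightarrow> (e k i, e k j) \<notin> step_rel M d r ^^ k"
  shows "chain_unbounded K d r"
  unfolding chain_unbounded_def
proof (intro allI impI notI)
  fix F k
  assume F: "finite F \<and> F \<subseteq> K" and cover: "K \<subseteq> (step_rel K d r ^^ k) `` F"
  \<comment> \<open>Chains inside \<open>K\<close> are chains inside \<open>M\<close>, where the
    separation of \<open>e\<close> is known.\<close>
  have "\<forall>n. \<exists>f\<in>F. (f, e (k + k) n) \<in> step_rel M d r ^^ k"
    using cover e(1)[of "k + k"] step_rel_pow_mono[OF assms(1), where d = d and r = r and k = k] by blast
  then obtain f where f: "\<And>n. f n \<in> F" "\<And>n. (f n, e (k + k) n) \<in> step_rel M d r ^^ k"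
    by metis
  have "\<not> inj f"
  proof
    assume "inj f"
    moreover have "finite (range f)"
      using F f(1) by (auto intro: finite_subset)
    ultimately show False
      by (simp add: finite_image_iff)
  qed
  then obtain i j where "i \<noteq> j" "f i = f j"
    by (auto simp: inj_def)
  then obtain i j where ij: "i < j" "f i = f j"
    by (cases i j rule: linorder_cases) auto
  have "(e (k + k) i, f i) \<in> step_rel M d r ^^ k"
    using f(2) by (rule step_rel_pow_sym)
  moreover have "(f i, e (k + k) j) \<in> step_rel M d r ^^ k"
    using f(2)[of j] ij(2) by simp
  ultimately have "(e (k + k) i, e (k + k) j) \<in> step_rel M d r ^^ (k + k)"
    unfolding relpow_add by (rule relcompI)
  with e(2)[OF ij(1)] show False
    by blast
qed

text \<open>The density of \<open>K\<close> is bounded above through its dense subgroup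
  \<open>L\<close>, in whose size the countable set \<open>E\<close> is absorbed by the summand
  \<open>natLeq\<close>. The lower bound is heredity of density for \<open>C\<close> inside
  \<open>K\<close>.\<close>

lemma (in metric_group) ex_unbounded_closed_subgroup:
  assumes unb: "chain_unbounded (carrier G) d r" and C: "C \<subseteq> carrier G"
  obtains K where "subgroup K G" "closedin mtopology K" "C \<subseteq> K" "chain_unbounded K d r"
    "density_character (Metric_space.mtopology K d) =o density_character (Metric_space.mtopology C d)"
proof -
  interpret C: Metric_space C d
    using C by (rule subspace)
  obtain D where D: "dense_subset C.mtopology D"
    and dens: "density_character C.mtopology = natLeq +c |D|"
    by (rule density_characterE)
  let ?r = "natLeq +c |D|"
  have "\<exists>e :: nat \<Rightarrow> 'a. range e \<subseteq> carrier G
      \<and> (\<forall>i j. i < j \<longrightarrow> (e i, e j) \<notin> step_rel (carrier G) d r ^^ k)" for k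
    using unb by (rule ex_separated_sequence)
  then obtain e :: "nat \<Rightarrow> nat \<Rightarrow> 'a" where e: "\<And>k. range (e k) \<subseteq> carrier G"
    "\<And>k i j. i < j \<Longrightarrow> (e k i, e k j) \<notin> step_rel (carrier G) d r ^^ k"
    by metis
  define E where "E = (\<Union>k. range (e k))"
  have "countable E"
    by (simp add: E_def)
  then have "|E| \<le>o ?r"
    unfolding countable_card_le_natLeq
    using ordLeq_csum1[OF natLeq_Card_order] by (rule ordLeq_transitive)
  then have "|E \<union> D| \<le>o ?r"
    using Cinfinite_natLeq_csum[of "|D|"] card_of_le_natLeq_csum
    by (intro card_of_Un_ordLeq_infinite_Field) (auto simp: cinfinite_def)
  moreover have "E \<union> D \<subseteq> carrier G"
    using e(1) D C unfolding E_def C.dense_subset_iff by blast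
  ultimately obtain L where L: "subgroup L G" "E \<union> D \<subseteq> L" "|L| \<le>o ?r"
    using ex_small_subgroup[OF _ _ Cinfinite_natLeq_csum] by metis
  define K where "K = mtopology closure_of L"
  have L_sub: "L \<subseteq> carrier G"
    using L(1) by (rule subgroup.subset)
  have LK: "L \<subseteq> K"
    unfolding K_def using L_sub by (simp add: closure_of_subset)
  have K_sub: "K \<subseteq> carrier G"
    by (auto simp: K_def metric_closure_of)
  interpret K: Metric_space K d
    using K_sub by (rule subspace)
  have "C \<subseteq> K"
  proof
    fix x assume x: "x \<in> C"
    have "\<exists>y\<in>L. y \<in> mball x \<epsilon>" if "0 < \<epsilon>" for \<epsilon>
    proof -
      obtain y where "y \<in> D" "d x y < \<epsilon>"
        using D x \<open>0 < \<epsilon>\<close> unfolding C.dense_subset_iff by blast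
      then show ?thesis
        using L(2) L_sub x C by (intro bexI[of _ y]) auto
    qed
    then show "x \<in> K"
      using x C by (auto simp: K_def metric_closure_of)
  qed
  moreover have "chain_unbounded K d r"
  proof (rule chain_unbounded_subset[OF K_sub])
    show "range (e k) \<subseteq> K" for k
      using L(2) LK unfolding E_def by blast
  qed (rule e(2))
  moreover have "density_character K.mtopology =o density_character C.mtopology"
  proof -
    have "dense_subset K.mtopology L"
      unfolding K.dense_subset_iff using LK by (auto simp: K_def metric_closure_of)
    then have "density_character K.mtopology \<le>o natLeq +c |L|"
      by (rule density_character_le)
    also have "natLeq +c |L| \<le>o ?r"
      using Cinfinite_natLeq_csum L(3) by (rule natLeq_csum_least)
    finally show ?thesis
      using K.density_character_mono[OF \<open>C \<subseteq> K\<close>] unfolding dens ordIso_iff_ordLeq by blast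
  qed
  moreover have "subgroup K G" "closedin mtopology K"
    unfolding K_def using subgroup_closure[OF L(1)] by auto
  ultimately show ?thesis
    using that by blast
qed

text \<open>The subgroup is unbounded at the same scale \<open>r\<close> as the whole group, and it
  is complete because it is closed.\<close>

theorem bountiful_uniformly_non_OB:
  "bountiful (uniformly_non_OB :: 'a monoid \<Rightarrow> ('a \<Rightarrow> 'a \<Rightarrow> real) \<Rightarrow> bool)"
  unfolding bountiful_def
proof (intro allI impI)
  fix H :: "'a monoid" and d C
  assume H: "uniformly_non_OB H d \<and> infinite (carrier H)" and C: "C \<subseteq> carrier H"
  then interpret metric_group H d
    by (simp add: uniformly_non_OB_iff)
  obtain r where r: "0 < r" "chain_unbounded (carrier H) d r"
    using H by (auto simp: uniformly_non_OB_iff)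
  obtain K where K: "subgroup K H" "closedin mtopology K" "C \<subseteq> K" "chain_unbounded K d r"
    "density_character (Metric_space.mtopology K d) =o density_character (Metric_space.mtopology C d)"
    using ex_unbounded_closed_subgroup[OF r(2) C] by blast
  have "uniformly_non_OB (H\<lparr>carrier := K\<rparr>) d"
    unfolding uniformly_non_OB_iff
    using metric_group_closed_subgroup[OF K(1,2)] K(4) r(1) by auto
  with K show "\<exists>K. uniformly_non_OB (H\<lparr>carrier := K\<rparr>) d \<and> C \<subseteq> K \<and> subgroup K H \<and>
      density_character (Metric_space.mtopology K d) =o density_character (Metric_space.mtopology C d)"
    by blast
qed

theorem theorem4p4:
  shows "(\<forall>(G :: 'a monoid) d. metric_group G d \<longrightarrow>
           (uniformly_non_OB G d \<longleftrightarrow>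
             (\<exists>s :: nat \<times> nat \<Rightarrow> nat. (\<forall>m k. s (m, k) > 0) \<and>
               (\<exists>d' P Q. grey_expansion G d d' P Q \<and>
                 (\<forall>m k. theta G d' P m k (1 / real (s (m, k))))))))
         \<and> bountiful (uniformly_non_OB :: 'a monoid \<Rightarrow> ('a \<Rightarrow> 'a \<Rightarrow> real) \<Rightarrow> bool)"
  using uniformly_non_OB_iff_grey bountiful_uniformly_non_OB by blast

end
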